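(* Let $1\le p\le 2$ and $\phi\in\mathcal{L}^p(\mathbb{R})\cap BV_0(\mathbb{R})\cap AC_{loc}(\mathbb{R})$. Then: (i) $\mathcal{F}_{HK}(\phi)\in C_\infty(\mathbb{R}\setminus\{0\})$; (ii) $\mathcal{F}_{HK}(\phi)(s)=\mathcal{F}_p(\phi)(s)$ for almost every $s\in\mathbb{R}$; (iii) $\phi'\in\mathcal{L}^1(\mathbb{R})$ and for every $s\in\mathbb{R}\setminus\{0\}$, $$\mathcal{F}_{HK}(\phi)(s)=-\frac{i}{s}\,\mathcal{F}_1(\phi')(s);$$ (iv) for every $s\neq 0$, $\displaystyle |\mathcal{F}_{HK}(\phi)(s)|\le \frac{1}{\sqrt{2\pi}}\cdot\frac{1}{|s|}\,\|\phi'\|_1$.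
   Context: $BV_0(\mathbb{R})$: real functions of bounded variation on $\mathbb{R}$ vanishing at $\pm\infty$. $AC_{loc}(\mathbb{R})$: functions absolutely continuous on each compact interval. $C_\infty(\mathbb{R}\setminus\{0\})$: complex-valued continuous functions on $\mathbb{R}\setminus\{0\}$ vanishing at $\pm\infty$. For $f\in\mathcal{L}^1(\mathbb{R})$, $\mathcal{F}_1(f)(s)=\frac{1}{\sqrt{2\pi}}\int_{\mathbb{R}}e^{-isx}f(x)\,dx$ (Lebesgue integral). $\mathcal{F}_2$ is the Plancherel extension of $\mathcal{F}_1$ from $\mathcal{L}^1\cap\mathcal{L}^2$ to $\mathcal{L}^2(\mathbb{R})$. For $1<p<2$, $\mathcal{F}_p:\mathcal{L}^p(\mathbb{R})\to\mathcal{L}^q(\mathbb{R})$ ($p^{-1}+q^{-1}=1$) is $\mathcal{F}_p(f)=\mathcal{F}_1(f_1)+\mathcal{F}_2(f_2)$ where $f=f_1+f_2$, $f_1\in\mathcal{L}^1\cap\mathcal{L}^p$, $f_2\in\mathcal{L}^2\cap\mathcal{L}^p$ (defined a.e.). For $f=f_1+f_2$ with $f_1\in\mathcal{L}^1(\mathbb{R})$, $f_2\in BV_0(\mathbb{R})$, and $s\neq0$, the $HK$-Fourier transform is $\mathcal{F}_{HK}(f)(s)=\frac{1}{\sqrt{2\pi}}\int_{\mathbb{R}}e^{-isx}f(x)\,dx$, the integral being the Henstock–Kurzweil integral over $\mathbb{R}$ (which extends the Lebesgue and improper Riemann integrals; it equals $\lim_{T\to\infty}\frac{1}{\sqrt{2\pi}}\int_{-T}^{T}e^{-isx}f(x)dx$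 when it exists). *)

theory Defs
  imports "HOL-Analysis.Analysis"
begin

definition Lp :: "real \<Rightarrow> (real \<Rightarrow> complex) \<Rightarrow> bool" where
  "Lp p f \<longleftrightarrow> f \<in> borel_measurable lebesgue \<and>
                integrable lebesgue (\<lambda>x. norm (f x) powr p)"

definition bounded_variation :: "(real \<Rightarrow> real) \<Rightarrow> bool" where
  "bounded_variation f \<longleftrightarrow> (\<exists>B. \<forall>(n::nat) (x::nat \<Rightarrow> real).
      (\<forall>i<n. x i \<le> x (Suc i)) \<longrightarrow> (\<Sum>i<n. \<bar>f (x (Suc i)) - f (x i)\<bar>) \<le> B)"

definition BV0 :: "(real \<Rightarrow> real) \<Rightarrow> bool" where
  "BV0 f \<longleftrightarrow> bounded_variation f \<and> (f \<longlongrightarrow> 0) at_top \<and> (f \<longlongrightarrow> 0) at_bot"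

definition abs_cont_on :: "(real \<Rightarrow> real) \<Rightarrow> real \<Rightarrow> real \<Rightarrow> bool" where
  "abs_cont_on f a b \<longleftrightarrow> (\<forall>\<epsilon>>0. \<exists>\<delta>>0. \<forall>(n::nat) (u::nat \<Rightarrow> real) (v::nat \<Rightarrow> real).
      (\<forall>i<n. a \<le> u i \<and> u i \<le> v i \<and> v i \<le> b) \<and>
      (\<forall>i<n. \<forall>j<n. i \<noteq> j \<longrightarrow> v i \<le> u j \<or> v j \<le> u i) \<and>
      (\<Sum>i<n. v i - u i) < \<delta>
      \<longrightarrow> (\<Sum>i<n. \<bar>f (v i) - f (u i)\<bar>) < \<epsilon>)"

definition AC_loc :: "(real \<Rightarrow> real) \<Rightarrow> bool" where
  "AC_loc f \<longleftrightarrow> (\<forall>a b. a \<le> b \<longrightarrow> abs_cont_on f a b)"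

definition C_infty_punct :: "(real \<Rightarrow> complex) \<Rightarrow> bool" where
  "C_infty_punct g \<longleftrightarrow> continuous_on (-{0}) g \<and> (g \<longlongrightarrow> 0) at_top \<and> (g \<longlongrightarrow> 0) at_bot"

definition Fourier1 :: "(real \<Rightarrow> complex) \<Rightarrow> real \<Rightarrow> complex" where
  "Fourier1 f s = complex_of_real (1 / sqrt (2 * pi)) *
      (\<integral>x. exp (- (\<i> * complex_of_real (s * x))) * f x \<partial>lebesgue)"

text \<open>Plancherel transform: the L^2-continuous extension of Fourier1 from L^1 \<inter> L^2
  (determined up to a.e. equality; SOME picks a representative).\<close>
definition Fourier2 :: "(real \<Rightarrow> complex) \<Rightarrow> real \<Rightarrow> complex" where
  "Fourier2 f = (SOME g. Lp 2 g \<and>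
     (\<forall>F :: nat \<Rightarrow> real \<Rightarrow> complex.
        (\<forall>n. Lp 1 (F n) \<and> Lp 2 (F n)) \<and>
        (\<lambda>n. \<integral>x. norm (F n x - f x) ^ 2 \<partial>lebesgue) \<longlonglongrightarrow> 0
        \<longrightarrow> (\<lambda>n. \<integral>s. norm (Fourier1 (F n) s - g s) ^ 2 \<partial>lebesgue) \<longlonglongrightarrow> 0))"

definition Fourier_p :: "real \<Rightarrow> (real \<Rightarrow> complex) \<Rightarrow> real \<Rightarrow> complex" where
  "Fourier_p p f =
     (if p = 1 then Fourier1 f
      else if p = 2 then Fourier2 f
      else (SOME g. \<exists>f1 f2. (\<forall>x. f x = f1 x + f2 x) \<and>
              Lp 1 f1 \<and> Lp p f1 \<and> Lp 2 f2 \<and> Lp p f2 \<and>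
              g = (\<lambda>s. Fourier1 f1 s + Fourier2 f2 s)))"

text \<open>HK-Fourier transform: Henstock-Kurzweil integral over R (Isabelle's integral on UNIV).\<close>
definition FourierHK :: "(real \<Rightarrow> complex) \<Rightarrow> real \<Rightarrow> complex" where
  "FourierHK f s = complex_of_real (1 / sqrt (2 * pi)) *
      integral UNIV (\<lambda>x. exp (- (\<i> * complex_of_real (s * x))) * f x)"

end

(* The function \<phi> is the indefinite integral of some integrable g: its variation function is again
   absolutely continuous, so the Stieltjes measures of the variation V and of V - \<phi> have densities,
   and the Henstock lemma with Vitali's covering theorem gives \<phi>' = g almost everywhere.
   Integration by parts on [a, b] and a, b \<rightarrow> \<plusminus>\<infinity> then express the HK-Fourier transform of \<phi>
   through the L^1 transform of \<phi>'.

   For the comparison with the L^p transform, write \<phi> = f1 + f2 with f1 in L^1 and f2 in L^2. The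
   transforms of the truncations of f2 to [-n, n] are differences of those of \<phi> and f1, so they
   converge pointwise off 0 to FHK(\<phi>) - F1(f1). The bound norm (F1 h) \<le> norm h in L^2, proved by
   Gaussian regularisation, and Fatou's lemma make this limit the Plancherel transform of f2. *)

theory Submission
  imports Defs "HOL-Probability.Characteristic_Functions"
begin

section \<open>Absolutely continuous functions of bounded variation\<close>

text \<open>Two obstacles shape the proof. For p > 1 the function \<phi> need not be integrable, so
  its transform off 0 may converge only conditionally, and everything has to pass through compact
  intervals. The truncations to [-n, n] fit this: their transforms are partial integrals of the HK
  integral, and they approximate \<open>f2\<close> in L^2 at the same time. Moreover
  \<open>Fourier2\<close> and \<open>Fourier_p\<close> are choices of a witness, so nothing is known
  about them until a function with the defining property is exhibited; the pointwise limit is such a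
  function, and the choice agrees with it a.e. because L^2 limits are unique up to null sets. The
  variation enters because a Stieltjes measure belongs to a monotone function: V and V - \<phi> are
  both monotone, and g is the difference of their densities. This only represents \<phi> as an
  integral; that \<phi>' = g a.e. is a separate fact, required because the claim speaks of
  \<open>deriv\<close>. The factor 2 pi in the unnormalised L^2 bound is the mass of the Fourier
  transform of a Gaussian of height 1; the normalisation of \<open>Fourier1\<close> cancels
  it.\<close>

definition ac_modulus :: "(real \<Rightarrow> real) \<Rightarrow> real \<Rightarrow> real \<Rightarrow> real \<Rightarrow> real \<Rightarrow> bool" where
  "ac_modulus f a b e d \<longleftrightarrow> (\<forall>(n::nat) (u::nat \<Rightarrow> real) (v::nat \<Rightarrow> real).
      (\<forall>i<n. a \<le> u i \<and> u i \<le> v i \<and> v i \<le> b) \<and>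
      (\<forall>i<n. \<forall>j<n. i \<noteq> j \<longrightarrow> v i \<le> u j \<or> v j \<le> u i) \<and>
      (\<Sum>i<n. v i - u i) < d
      \<longrightarrow> (\<Sum>i<n. \<bar>f (v i) - f (u i)\<bar>) < e)"

lemma abs_cont_on_iff_modulus: "abs_cont_on f a b \<longleftrightarrow> (\<forall>e>0. \<exists>d>0. ac_modulus f a b e d)"
  unfolding abs_cont_on_def ac_modulus_def ..

text \<open>Enumerating \<open>I\<close> leads back to the initial segments of nat in the
  definition. The applications index their intervals otherwise: by a single point, by pairs of
  indices, or by a finite set of intervals that indexes itself.\<close>

lemma ac_modulusD:
  fixes I :: "'i set"
  assumes d: "ac_modulus f a b e d" and I: "finite I"
    "\<And>i. i \<in> I \<Longrightarrow> a \<le> u i \<and> u i \<le> v i \<and> v i \<le> b"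
    "\<And>i j. \<lbrakk>i \<in> I; j \<in> I; i \<noteq> j\<rbrakk> \<Longrightarrow> v i \<le> u j \<or> v j \<le> u i" "(\<Sum>i\<in>I. v i - u i) < d"
  shows "(\<Sum>i\<in>I. \<bar>f (v i) - f (u i)\<bar>) < e"
proof -
  obtain h where h: "bij_betw h {..<card I} I"
    using ex_bij_betw_nat_finite[OF I(1)] by (auto simp: atLeast0LessThan)
  have inI: "h i \<in> I" if "i < card I" for i
    using bij_betwE[OF h] that by auto
  have neq: "h i \<noteq> h j" if "i < card I" "j < card I" "i \<noteq> j" for i j
    using bij_betw_imp_inj_on[OF h] that by (auto dest: inj_onD)
  have "(\<Sum>i<card I. v (h i) - u (h i)) < d"
    using sum.reindex_bij_betw[OF h, of "\<lambda>i. v i - u i"] I(4) by simp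
  then have "(\<Sum>i<card I. \<bar>f (v (h i)) - f (u (h i))\<bar>) < e"
    using d[unfolded ac_modulus_def, rule_format, of "card I" "u \<circ> h" "v \<circ> h"] I(2,3) inI neq by auto
  then show ?thesis
    using sum.reindex_bij_betw[OF h, of "\<lambda>i. \<bar>f (v i) - f (u i)\<bar>"] by simp
qed

section \<open>The variation function on half-lines\<close>

definition partition_sums :: "(real \<Rightarrow> real) \<Rightarrow> real \<Rightarrow> real set" where
  "partition_sums f t = {\<Sum>i<n. \<bar>f (x (Suc i)) - f (x i)\<bar> | (n::nat) x.
     (\<forall>i<n. x i \<le> x (Suc i)) \<and> (\<forall>i\<le>n. x i \<le> t)}"

text \<open>The variation is counted from minus infinity. No base point is chosen, one function
  serves the whole line, and a bound for the total variation bounds it uniformly in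
  \<open>t\<close>.\<close>

definition variation_upto :: "(real \<Rightarrow> real) \<Rightarrow> real \<Rightarrow> real" where
  "variation_upto f t = Sup (partition_sums f t)"

lemma bdd_above_partition_sums:
  assumes "bounded_variation f"
  shows "bdd_above (partition_sums f t)"
  using assms unfolding bounded_variation_def partition_sums_def bdd_above_def by blast

lemma zero_in_partition_sums: "0 \<in> partition_sums f t"
  unfolding partition_sums_def by (rule CollectI, rule exI[of _ 0], rule exI[of _ "\<lambda>_. t"]) auto

lemma partition_sums_le_variation_upto:
  assumes "bounded_variation f" "\<forall>i<n. x i \<le> x (Suc i)" "\<forall>i\<le>n. x i \<le> t"
  shows "(\<Sum>i<n. \<bar>f (x (Suc i)) - f (x i)\<bar>) \<le> variation_upto f t"
  unfolding variation_upto_def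
  by (rule cSup_upper[OF _ bdd_above_partition_sums[OF assms(1)]])
     (use assms in \<open>auto simp: partition_sums_def\<close>)

lemma variation_upto_bounds:
  assumes "bounded_variation f"
  obtains B where "\<And>t. 0 \<le> variation_upto f t" "\<And>t. variation_upto f t \<le> B"
proof -
  obtain B where B: "\<And>t s. s \<in> partition_sums f t \<Longrightarrow> s \<le> B"
    using assms unfolding bounded_variation_def partition_sums_def by blast
  show thesis
  proof
    show "0 \<le> variation_upto f t" for t
      unfolding variation_upto_def
      by (rule cSup_upper[OF zero_in_partition_sums bdd_above_partition_sums[OF assms]])
    show "variation_upto f t \<le> B" for t
      unfolding variation_upto_def
      by (rule cSup_least) (use zero_in_partition_sums B in blast)+
  qed
qed

text \<open>A partition ending before \<open>x\<close> can be prolonged by the points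
  \<open>x\<close> and \<open>y\<close>: the step to \<open>x\<close> adds a nonnegative term and
  the step to \<open>y\<close> adds the increment of \<open>f\<close>. The estimate makes both
  \<open>variation_upto f\<close> and its difference with \<open>f\<close> monotone.\<close>

lemma variation_upto_increment_ge:
  assumes bv: "bounded_variation f" and "x \<le> y"
  shows "\<bar>f y - f x\<bar> \<le> variation_upto f y - variation_upto f x"
proof -
  have "variation_upto f x \<le> variation_upto f y - \<bar>f y - f x\<bar>"
    unfolding variation_upto_def[of f x]
  proof (rule cSup_least)
    show "partition_sums f x \<noteq> {}"
      using zero_in_partition_sums by blast
  next
    fix r assume "r \<in> partition_sums f x"
    then obtain n z where r: "r = (\<Sum>i<n. \<bar>f (z (Suc i)) - f (z i)\<bar>)"
      and z: "\<forall>i<n. z i \<le> z (Suc i)" "\<forall>i\<le>n. z i \<le> x"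
      unfolding partition_sums_def by blast
    define w where "w i = (if i \<le> n then z i else if i = Suc n then x else y)" for i
    have "(\<Sum>i<n. \<bar>f (w (Suc i)) - f (w i)\<bar>) = r"
      unfolding r w_def by (rule sum.cong) auto
    moreover have "\<forall>i<Suc (Suc n). w i \<le> w (Suc i)" "\<forall>i\<le>Suc (Suc n). w i \<le> y"
      using z \<open>x \<le> y\<close> unfolding w_def by (force simp: less_Suc_eq)+
    note partition_sums_le_variation_upto[OF bv this]
    moreover have "w (Suc n) = x" "w (Suc (Suc n)) = y" by (auto simp: w_def)
    ultimately show "r \<le> variation_upto f y - \<bar>f y - f x\<bar>"
      by simp
  qed
  then show ?thesis by simp
qed

text \<open>A partition of \<open>{..y}\<close> is cut at \<open>x\<close> by taking pointwise \<open>min\<close> and \<open>max\<close> with \<open>x\<close>;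
  this inserts the point \<open>x\<close> without any reindexing.\<close>

lemma variation_upto_increment_le:
  assumes bv: "bounded_variation f" and "x \<le> y" "0 < e"
  shows "\<exists>(n::nat) s. (\<forall>i<n. s i \<le> s (Suc i)) \<and> (\<forall>i\<le>n. x \<le> s i \<and> s i \<le> y) \<and>
    variation_upto f y - variation_upto f x \<le> (\<Sum>i<n. \<bar>f (s (Suc i)) - f (s i)\<bar>) + e"
proof -
  have "variation_upto f y - e < Sup (partition_sums f y)"
    using \<open>0 < e\<close> by (simp add: variation_upto_def)
  then obtain r where "r \<in> partition_sums f y" and r: "variation_upto f y - e < r"
    using less_cSupE zero_in_partition_sums by (metis empty_iff)
  then obtain n z where r': "r = (\<Sum>i<n. \<bar>f (z (Suc i)) - f (z i)\<bar>)"
    and z: "\<forall>i<n. z i \<le> z (Suc i)" "\<forall>i\<le>n. z i \<le> y"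
    unfolding partition_sums_def by blast
  define a where "a i = min (z i) x" for i
  define b where "b i = max (z i) x" for i
  have "(\<Sum>i<n. \<bar>f (a (Suc i)) - f (a i)\<bar>) \<le> variation_upto f x"
    by (rule partition_sums_le_variation_upto[OF bv]) (use z in \<open>auto simp: a_def min_def intro: order_trans\<close>)
  moreover have "r \<le> (\<Sum>i<n. \<bar>f (a (Suc i)) - f (a i)\<bar> + \<bar>f (b (Suc i)) - f (b i)\<bar>)"
    unfolding r'
  proof (rule sum_mono)
    fix i assume "i \<in> {..<n}"
    then have "z i \<le> z (Suc i)" using z by auto
    then consider "z (Suc i) \<le> x" | "x \<le> z i" | "z i \<le> x" "x \<le> z (Suc i)" by linarith
    then show "\<bar>f (z (Suc i)) - f (z i)\<bar> \<le> \<bar>f (a (Suc i)) - f (a i)\<bar> + \<bar>f (b (Suc i)) - f (b i)\<bar>"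
      using \<open>z i \<le> z (Suc i)\<close> by cases (auto simp: a_def b_def min_def max_def)
  qed
  ultimately have "variation_upto f y - variation_upto f x \<le> (\<Sum>i<n. \<bar>f (b (Suc i)) - f (b i)\<bar>) + e"
    using r by (simp add: sum.distrib)
  moreover have "\<forall>i<n. b i \<le> b (Suc i)" "\<forall>i\<le>n. x \<le> b i \<and> b i \<le> y"
    using z \<open>x \<le> y\<close> by (auto simp: b_def max_def intro: order_trans)
  ultimately show ?thesis by (intro exI[of _ n] exI[of _ b] conjI)
qed

lemma chain_le:
  fixes s :: "nat \<Rightarrow> real"
  assumes "\<forall>i<n. s i \<le> s (Suc i)" "i \<le> j" "j \<le> n"
  shows "s i \<le> s j"
  using assms(2,3)
proof (induction j rule: dec_induct)
  case (step j)
  then show ?case using assms(1) by (meson Suc_le_eq order_trans less_imp_le)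
qed simp

text \<open>On each [u i, v i] some partition attains the increment of the variation up to a small
  error. All these partition intervals together still form a nonoverlapping family of total length
  below \<open>d\<close>, so a modulus of \<open>f\<close> for e/2 serves the variation for
  \<open>e\<close>.\<close>

lemma abs_cont_on_variation_upto:
  assumes bv: "bounded_variation f" and ac: "abs_cont_on f a b"
  shows "abs_cont_on (variation_upto f) a b"
  unfolding abs_cont_on_def
proof (intro allI impI)
  fix e :: real assume "0 < e"
  then have "0 < e/2" by simp
  then obtain d where "0 < d" and d: "ac_modulus f a b (e/2) d"
    using ac unfolding abs_cont_on_iff_modulus by meson
  show "\<exists>\<delta>>0. \<forall>(n::nat) u v.
      (\<forall>i<n. a \<le> u i \<and> u i \<le> v i \<and> v i \<le> b) \<and>
      (\<forall>i<n. \<forall>j<n. i \<noteq> j \<longrightarrow> v i \<le> u j \<or> v j \<le> u i) \<and>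
      (\<Sum>i<n. v i - u i) < \<delta>
      \<longrightarrow> (\<Sum>i<n. \<bar>variation_upto f (v i) - variation_upto f (u i)\<bar>) < e"
  proof (intro exI[of _ d] conjI \<open>0 < d\<close> allI impI, elim conjE)
    fix n :: nat and u v
    assume uv: "\<forall>i<n. a \<le> u i \<and> u i \<le> v i \<and> v i \<le> b"
      and disj: "\<forall>i<n. \<forall>j<n. i \<noteq> j \<longrightarrow> v i \<le> u j \<or> v j \<le> u i"
      and less: "(\<Sum>i<n. v i - u i) < d"
    \<comment> \<open>With \<open>Suc n\<close> the denominator is nonzero even for n = 0, and the n
      errors add up to strictly less than e/2.\<close>
    define e' where "e' = e / (2 * real (Suc n))"
    have "0 < e'" using \<open>0 < e\<close> by (simp add: e'_def)
    define Q where "Q i N s \<longleftrightarrow> (\<forall>k<N. s k \<le> s (Suc k)) \<and> (\<forall>k\<le>N. u i \<le> s k \<and> s k \<le> v i) \<and>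
       variation_upto f (v i) - variation_upto f (u i) \<le> (\<Sum>k<N. \<bar>f (s (Suc k)) - f (s k)\<bar>) + e'"
      for i and N :: nat and s
    have "\<exists>N s. Q i N s" if "i < n" for i
    proof -
      have "u i \<le> v i" using uv that by blast
      then show ?thesis
        unfolding Q_def by (rule variation_upto_increment_le[OF bv _ \<open>0 < e'\<close>])
    qed
    then obtain N s where Q: "\<And>i. i < n \<Longrightarrow> Q i (N i) (s i)" by metis
    have mono: "\<forall>k<N i. s i k \<le> s i (Suc k)" if "i < n" for i
      using Q[OF that] unfolding Q_def by blast
    have bnd: "u i \<le> s i k \<and> s i k \<le> v i" if "i < n" "k \<le> N i" for i k
      using Q[OF that(1)] that(2) unfolding Q_def by blast
    have var: "variation_upto f (v i) - variation_upto f (u i)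
           \<le> (\<Sum>k<N i. \<bar>f (s i (Suc k)) - f (s i k)\<bar>) + e'" if "i < n" for i
      using Q[OF that] unfolding Q_def by blast
    define J where "J = (SIGMA i:{..<n}. {..<N i})"
    have sums: "(\<Sum>p\<in>J. g (fst p) (snd p)) = (\<Sum>i<n. \<Sum>k<N i. g i k)" for g :: "nat \<Rightarrow> nat \<Rightarrow> real"
      unfolding J_def by (simp add: sum.Sigma split_def)
    have "(\<Sum>p\<in>J. s (fst p) (Suc (snd p)) - s (fst p) (snd p)) = (\<Sum>i<n. s i (N i) - s i 0)"
      by (subst sums) (simp add: sum_lessThan_telescope)
    also have "\<dots> \<le> (\<Sum>i<n. v i - u i)"
      using bnd by (intro sum_mono diff_mono) auto
    also note less
    finally have len: "(\<Sum>p\<in>J. s (fst p) (Suc (snd p)) - s (fst p) (snd p)) < d" .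
    have "(\<Sum>p\<in>J. \<bar>f (s (fst p) (Suc (snd p))) - f (s (fst p) (snd p))\<bar>) < e/2"
    proof (rule ac_modulusD[OF d _ _ _ len])
      show "finite J" by (simp add: J_def)
      show "a \<le> s (fst p) (snd p) \<and> s (fst p) (snd p) \<le> s (fst p) (Suc (snd p)) \<and> s (fst p) (Suc (snd p)) \<le> b"
        if "p \<in> J" for p
      proof -
        have "fst p < n" "snd p < N (fst p)" using that by (auto simp: J_def)
        then show ?thesis using uv bnd[of "fst p" "snd p"] bnd[of "fst p" "Suc (snd p)"] mono
          by (meson Suc_leI less_imp_le order_trans)
      qed
      \<comment> \<open>Two pieces of the same [u i, v i] are separated by the order of its
        partition points, pieces of different ones by the assumption on the outer family.\<close>
      show "s (fst p) (Suc (snd p)) \<le> s (fst q) (snd q) \<or> s (fst q) (Suc (snd q)) \<le> s (fst p) (snd p)"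
        if "p \<in> J" "q \<in> J" "p \<noteq> q" for p q
      proof (cases "fst p = fst q")
        case True
        have p: "fst p < n" "snd p < N (fst p)" "snd q < N (fst p)" using that True by (auto simp: J_def)
        from True that have "snd p \<noteq> snd q" by (auto simp: prod_eq_iff)
        then have "Suc (snd p) \<le> snd q \<or> Suc (snd q) \<le> snd p" by linarith
        then show ?thesis using chain_le[OF mono[OF p(1)]] p True by (metis less_imp_le)
      next
        case False
        have p: "fst p < n" "snd p < N (fst p)" "fst q < n" "snd q < N (fst q)"
          using that by (auto simp: J_def)
        with disj False have "v (fst p) \<le> u (fst q) \<or> v (fst q) \<le> u (fst p)" by blast
        then show ?thesis
          using bnd[OF p(1), of "snd p"] bnd[OF p(1), of "Suc (snd p)"]
            bnd[OF p(3), of "snd q"] bnd[OF p(3), of "Suc (snd q)"] p by linarith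
      qed
    qed
    then have small: "(\<Sum>i<n. \<Sum>k<N i. \<bar>f (s i (Suc k)) - f (s i k)\<bar>) < e/2"
      using sums[of "\<lambda>i k. \<bar>f (s i (Suc k)) - f (s i k)\<bar>"] by simp
    have "(\<Sum>i<n. \<bar>variation_upto f (v i) - variation_upto f (u i)\<bar>)
        \<le> (\<Sum>i<n. (\<Sum>k<N i. \<bar>f (s i (Suc k)) - f (s i k)\<bar>) + e')"
    proof (rule sum_mono)
      fix i assume "i \<in> {..<n}"
      then have "i < n" by simp
      then show "\<bar>variation_upto f (v i) - variation_upto f (u i)\<bar>
          \<le> (\<Sum>k<N i. \<bar>f (s i (Suc k)) - f (s i k)\<bar>) + e'"
        using variation_upto_increment_ge[OF bv, of "u i" "v i"] uv var[of i] by force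
    qed
    also have "\<dots> = (\<Sum>i<n. \<Sum>k<N i. \<bar>f (s i (Suc k)) - f (s i k)\<bar>) + real n * e'"
      by (simp add: sum.distrib)
    also have "\<dots> < e/2 + e/2"
    proof (rule add_strict_mono[OF small])
      have "real n * e < e * real (Suc n)" using \<open>0 < e\<close> by (simp add: field_simps)
      then show "real n * e' < e/2"
        unfolding e'_def by (simp add: field_simps)
    qed
    finally show "(\<Sum>i<n. \<bar>variation_upto f (v i) - variation_upto f (u i)\<bar>) < e" by simp
  qed
qed

lemma abs_cont_on_diff:
  assumes "abs_cont_on f a b" "abs_cont_on g a b"
  shows "abs_cont_on (\<lambda>x. f x - g x) a b"
  unfolding abs_cont_on_iff_modulus
proof (intro allI impI)
  fix e :: real assume "0 < e"
  then have e2: "0 < e/2" by simp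
  from assms e2 obtain d1 d2 where d: "d1 > 0" "ac_modulus f a b (e/2) d1" "d2 > 0" "ac_modulus g a b (e/2) d2"
    unfolding abs_cont_on_iff_modulus by meson
  show "\<exists>d>0. ac_modulus (\<lambda>x. f x - g x) a b e d"
  proof (intro exI[of _ "min d1 d2"] conjI)
    show "0 < min d1 d2" using d by simp
    show "ac_modulus (\<lambda>x. f x - g x) a b e (min d1 d2)"
      unfolding ac_modulus_def
    proof (intro allI impI)
      fix n :: nat and u v
      assume *: "(\<forall>i<n. a \<le> u i \<and> u i \<le> v i \<and> v i \<le> b) \<and>
        (\<forall>i<n. \<forall>j<n. i \<noteq> j \<longrightarrow> v i \<le> u j \<or> v j \<le> u i) \<and> (\<Sum>i<n. v i - u i) < min d1 d2"
      have "(\<Sum>i<n. \<bar>(f (v i) - g (v i)) - (f (u i) - g (u i))\<bar>)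
         \<le> (\<Sum>i<n. \<bar>f (v i) - f (u i)\<bar> + \<bar>g (v i) - g (u i)\<bar>)"
        by (intro sum_mono) linarith
      also have "\<dots> < e/2 + e/2"
        unfolding sum.distrib using *
        by (intro add_strict_mono ac_modulusD[OF d(2)] ac_modulusD[OF d(4)]) auto
      finally show "(\<Sum>i<n. \<bar>(f (v i) - g (v i)) - (f (u i) - g (u i))\<bar>) < e" by simp
    qed
  qed
qed

lemma AC_loc_imp_continuous_on:
  assumes "AC_loc f"
  shows "continuous_on UNIV f"
proof (rule continuous_at_imp_continuous_on, intro ballI)
  fix x :: real
  show "isCont f x"
    unfolding continuous_at_eps_delta
  proof (intro allI impI)
    fix e :: real assume "0 < e"
    moreover have "abs_cont_on f (x - 1) (x + 1)" using assms by (simp add: AC_loc_def)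
    ultimately obtain d where "0 < d" and d: "ac_modulus f (x - 1) (x + 1) e d"
      by (auto simp: abs_cont_on_iff_modulus)
    show "\<exists>d>0. \<forall>x'. dist x' x < d \<longrightarrow> dist (f x') (f x) < e"
    proof (intro exI[of _ "min d 1"] conjI allI impI)
      show "0 < min d 1" using \<open>0 < d\<close> by simp
      fix x' assume "dist x' x < min d 1"
      then show "dist (f x') (f x) < e"
        using ac_modulusD[OF d, of "{()}" "\<lambda>_. min x x'" "\<lambda>_. max x x'"]
        by (cases "x \<le> x'") (auto simp: dist_real_def min_def max_def split: if_splits)
    qed
  qed
qed

text \<open>Continuity from below along an enumeration of \<open>D\<close>. Both the modulus of
  absolute continuity and the Henstock lemma speak of finite families only; this carries their
  bounds over to countable covers.\<close>

lemma emeasure_countable_Union_le: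
  assumes "countable D" "D \<subseteq> sets M"
    and B: "\<And>D'. \<lbrakk>finite D'; D' \<subseteq> D\<rbrakk> \<Longrightarrow> emeasure M (\<Union>D') \<le> B"
  shows "emeasure M (\<Union>D) \<le> B"
proof (cases "D = {}")
  case True
  then show ?thesis by simp
next
  case False
  define h where "h = from_nat_into D"
  have h: "range h = D" "\<And>i. h i \<in> D"
    unfolding h_def using False \<open>countable D\<close> by (auto simp: from_nat_into)
  have "(SUP n. emeasure M (\<Union>(h ` {..<n}))) = emeasure M (\<Union>n. \<Union>(h ` {..<n}))"
  proof (rule SUP_emeasure_incseq)
    show "range (\<lambda>n. \<Union>(h ` {..<n})) \<subseteq> sets M"
      using h assms(2) by auto
    show "incseq (\<lambda>n. \<Union>(h ` {..<n}))"
      by (force simp: incseq_def)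
  qed
  also have "(\<Union>n. \<Union>(h ` {..<n})) = \<Union>D"
    using h(1) by auto
  finally show ?thesis
    using h by (metis (no_types, lifting) B SUP_least finite_imageI finite_lessThan image_subset_iff)
qed

text \<open>A bounded piece of a null set is covered by countably many nonoverlapping intervals of
  total length below the modulus \<open>d\<close>; absolute continuity then makes the increments of
  \<open>F\<close> over any finitely many of them sum to at most \<open>e\<close>.\<close>

lemma emeasure_interval_measure_AC_null:
  assumes mono: "mono F" and ac: "AC_loc F" and A: "A \<in> null_sets lborel"
  shows "emeasure (interval_measure F) A = 0"
proof -
  let ?N = "interval_measure F"
  have contF: "continuous_on UNIV F" by (rule AC_loc_imp_continuous_on[OF ac])
  have Abor: "A \<in> sets borel" using A by (auto simp: null_sets_def)
  have bounded_part: "emeasure ?N (A \<inter> {- real k..real k}) \<le> ennreal e" if "0 < e" "k \<ge> 1" for k :: nat and e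
  proof -
    let ?k = "real k"
    let ?B = "A \<inter> {-?k..?k}"
    have "\<exists>d>0. ac_modulus F (-?k) ?k e d"
      using ac \<open>0 < e\<close> by (simp add: AC_loc_def abs_cont_on_iff_modulus)
    then obtain d where "0 < d" and d: "ac_modulus F (-?k) ?k e d" by blast
    have nullB: "?B \<in> null_sets lebesgue"
      using A by (intro null_set_Int2 null_sets_completionI) auto
    then have B: "?B \<in> lmeasurable" "measure lebesgue ?B = 0"
      using negligible_iff_null_sets negligible_iff_measure by blast+
    have sub: "?B \<subseteq> cbox (-?k) ?k" by auto
    \<comment> \<open>The cover is longer than the null set by at most d/2, which keeps its total
      length strictly below \<open>d\<close>.\<close>
    have "0 < d/2" using \<open>0 < d\<close> by simp
    from measurable_outer_intervals_bounded[OF B(1) sub this]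
    obtain D where D: "countable D"
        "\<And>K. K \<in> D \<Longrightarrow> K \<subseteq> cbox (-?k) ?k \<and> K \<noteq> {} \<and> (\<exists>c d. K = cbox c d)"
        "pairwise (\<lambda>A B. interior A \<inter> interior B = {}) D"
        "\<And>K. \<lbrakk>K \<in> D; box (-?k) ?k \<noteq> {}\<rbrakk> \<Longrightarrow> interior K \<noteq> {}"
        "?B \<subseteq> \<Union>D" "\<Union>D \<in> lmeasurable" "measure lebesgue (\<Union>D) \<le> measure lebesgue ?B + d/2"
      by metis
    \<comment> \<open>The endpoints are recovered from the set \<open>K\<close> itself, so that a
      finite subset of \<open>D\<close> can serve as index set in \<open>ac_modulusD\<close>. The
      intervals are nondegenerate because \<open>k \<ge> 1\<close> makes the surrounding box
      nonempty; for the same reason the exhaustion of the line below uses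
      \<open>Suc k\<close>.\<close>
    have K: "K = {Inf K..Sup K}" "Inf K < Sup K" "-?k \<le> Inf K" "Sup K \<le> ?k" if KD: "K \<in> D" for K
    proof -
      obtain c d where cd: "K = {c..d}" using D(2)[OF KD] by (auto simp: cbox_interval)
      have "interior K \<noteq> {}" using D(4)[OF KD] \<open>k \<ge> 1\<close> by (auto simp: box_real)
      then have "c < d" using cd by (cases "c < d") auto
      then show "K = {Inf K..Sup K}" "Inf K < Sup K" "-?k \<le> Inf K" "Sup K \<le> ?k"
        using D(2)[OF KD] cd by (auto simp: cbox_interval)
    qed
    \<comment> \<open>A substitution principle: as a rewrite rule the equation
      \<open>K = {Inf K..Sup K}\<close> would loop.\<close>
    have KI: "P K" if "K \<in> D" "P {Inf K..Sup K}" for P and K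
      using arg_cong[OF K(1)[OF that(1)], of P] that(2) by (rule iffD2)
    have K_int: "interior K = {Inf K<..<Sup K}" if "K \<in> D" for K
      using arg_cong[OF K(1)[OF that], of interior] by simp
    have K_borel: "K \<in> sets borel" if "K \<in> D" for K
      by (rule KI[OF that, where P = "\<lambda>K. K \<in> sets borel"]) simp
    have K_lmeasurable: "K \<in> lmeasurable" if "K \<in> D" for K
      by (rule KI[OF that, where P = "\<lambda>K. K \<in> lmeasurable"]) simp
    have K_measure: "measure lebesgue K = Sup K - Inf K" if "K \<in> D" for K
      using arg_cong[OF K(1)[OF that], of "measure lebesgue"] K(2)[OF that] by simp
    have K_mem: "Inf K \<le> x \<and> x \<le> Sup K" if "K \<in> D" "x \<in> K" for K x
      using that(2) K(1)[OF that(1)] by (metis atLeastAtMost_iff)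
    have disj: "Sup K \<le> Inf L \<or> Sup L \<le> Inf K" if KL: "K \<in> D" "L \<in> D" "K \<noteq> L" for K L
    proof (rule ccontr)
      assume "\<not> ?thesis"
      then have *: "max (Inf K) (Inf L) < min (Sup K) (Sup L)"
        using K(2)[OF KL(1)] K(2)[OF KL(2)] by auto
      have "interior K \<inter> interior L = {}"
        using D(3) KL by (simp add: pairwise_def)
      moreover obtain z where "max (Inf K) (Inf L) < z" "z < min (Sup K) (Sup L)"
        using dense[OF *] by blast
      ultimately show False using K_int KL by auto
    qed
    have "emeasure ?N (\<Union>D) \<le> ennreal e"
    proof (rule emeasure_countable_Union_le[OF D(1)])
      show "D \<subseteq> sets ?N" using K_borel by auto
      fix D' assume D': "finite D'" "D' \<subseteq> D"
      have "(\<Sum>K\<in>D'. Sup K - Inf K) = (\<Sum>K\<in>D'. measure lebesgue K)"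
        using K_measure D' by (intro sum.cong) auto
      also have "\<dots> = measure lebesgue (\<Union>D')"
      proof (rule measure_negligible_finite_Union[symmetric, OF D'(1)])
        show "S \<in> lmeasurable" if "S \<in> D'" for S
          using K_lmeasurable that D' by auto
        show "pairwise (\<lambda>S T. negligible (S \<inter> T)) D'"
        proof (rule pairwiseI)
          fix S T assume ST: "S \<in> D'" "T \<in> D'" "S \<noteq> T"
          then have "S \<in> D" "T \<in> D" using D' by auto
          then have "S \<inter> T \<subseteq> {Sup S, Sup T}"
            using disj[OF _ _ ST(3)] K_mem[of S] K_mem[of T] by force
          then show "negligible (S \<inter> T)"
            using negligible_subset[OF negligible_finite] by (meson finite.emptyI finite_insert)
        qed
      qed
      also have "\<dots> \<le> measure lebesgue (\<Union>D)"
        using D(6) D' K_lmeasurable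
        by (intro measure_mono_fmeasurable Union_mono sets.finite_Union) auto
      also have "\<dots> < d" using D(7) B(2) \<open>0 < d\<close> by simp
      finally have "(\<Sum>K\<in>D'. Sup K - Inf K) < d" .
      then have "(\<Sum>K\<in>D'. \<bar>F (Sup K) - F (Inf K)\<bar>) < e"
        using disj K(2-4) D' by (intro ac_modulusD[OF d D'(1)]) (auto simp: less_imp_le subset_eq)
      then have *: "(\<Sum>K\<in>D'. F (Sup K) - F (Inf K)) \<le> e"
        by (smt (verit) sum_mono)
      have nn: "0 \<le> F (Sup K) - F (Inf K)" if "K \<in> D'" for K
        using K(2)[of K] that D' monoD[OF mono, of "Inf K" "Sup K"] by auto
      have eq: "emeasure ?N K = ennreal (F (Sup K) - F (Inf K))" if "K \<in> D'" for K
      proof -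
        have "K \<in> D" using that D' by auto
        then show ?thesis
          using emeasure_interval_measure_Icc[of "Inf K" "Sup K" F] monoD[OF mono] contF K(2)[of K]
            arg_cong[OF K(1), of K "emeasure ?N"] by simp
      qed
      have "emeasure ?N (\<Union>D') \<le> (\<Sum>K\<in>D'. emeasure ?N K)"
        using emeasure_subadditive_finite[OF D'(1), of "\<lambda>K. K" ?N] D' K_borel by auto
      also have "\<dots> = ennreal (\<Sum>K\<in>D'. F (Sup K) - F (Inf K))"
        using nn by (simp add: eq)
      also have "\<dots> \<le> ennreal e" using * by (rule ennreal_leI)
      finally show "emeasure ?N (\<Union>D') \<le> ennreal e" .
    qed
    moreover have "\<Union>D \<in> sets ?N"
      using K_borel by (intro sets.countable_Union D(1)) auto
    ultimately show ?thesis
      using emeasure_mono[OF D(5), of ?N] by (meson order_trans)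
  qed
  have zero: "emeasure ?N (A \<inter> {- real (Suc k)..real (Suc k)}) = 0" for k
  proof (rule ccontr)
    assume "\<not> ?thesis"
    then have pos: "0 < emeasure ?N (A \<inter> {- real (Suc k)..real (Suc k)})" by (simp add: zero_less_iff_neq_zero)
    then obtain e where "0 < e" "ennreal e < emeasure ?N (A \<inter> {- real (Suc k)..real (Suc k)})"
      using dense[OF pos] by (metis ennreal_cases ennreal_less_zero_iff less_ennreal.rep_eq not_less_iff_gr_or_eq top.not_eq_extremum)
    then show False using bounded_part[of e "Suc k"] by simp
  qed
  have "A = (\<Union>k. A \<inter> {- real (Suc k)..real (Suc k)})"
  proof -
    have "\<exists>k. x \<in> {- real (Suc k)..real (Suc k)}" for x :: real
    proof -
      obtain k :: nat where "\<bar>x\<bar> \<le> real k" using real_arch_simple by blast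
      then show ?thesis by (intro exI[of _ k]) auto
    qed
    then show ?thesis by blast
  qed
  moreover have "emeasure ?N (\<Union>k. A \<inter> {- real (Suc k)..real (Suc k)}) = 0"
    using zero Abor by (intro emeasure_UN_eq_0) auto
  ultimately show ?thesis by simp
qed

text \<open>\<open>g\<close> is the Radon-Nikodym derivative of the Stieltjes measure of
  \<open>F\<close>, made real-valued; this changes it on a null set only, since the measure is
  sigma-finite. Continuity of \<open>F\<close> excludes atoms, so {a..b} has measure exactly F b - F
  a.\<close>

lemma mono_AC_has_integral:
  assumes mono: "mono F" and ac: "AC_loc F"
  obtains g where "g \<in> borel_measurable borel" "\<And>x. 0 \<le> g x"
    "\<And>a b. a \<le> b \<Longrightarrow> (g has_integral F b - F a) {a..b}"
proof -
  let ?N = "interval_measure F"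
  have contF: "continuous_on UNIV F" by (rule AC_loc_imp_continuous_on[OF ac])
  have abs: "absolutely_continuous lborel ?N"
    unfolding absolutely_continuous_def
    using emeasure_interval_measure_AC_null[OF mono ac] by (auto simp: null_sets_def)
  have sN: "sets ?N = sets lborel" by simp
  have sf: "sigma_finite_measure ?N"
    using contF by (intro sigma_finite_interval_measure)
      (auto simp: monoD[OF mono] continuous_on_eq_continuous_within intro: continuous_within_subset)
  define f where "f = RN_deriv lborel ?N"
  have fm[measurable]: "f \<in> borel_measurable borel"
    unfolding f_def using borel_measurable_RN_deriv[of lborel ?N] by simp
  have dens: "density lborel f = ?N"
    unfolding f_def by (rule sigma_finite_measure.density_RN_deriv[OF sigma_finite_lborel abs sN])
  have fin: "AE x in lborel. f x \<noteq> \<infinity>"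
    unfolding f_def by (rule sigma_finite_measure.RN_deriv_finite[OF sigma_finite_lborel sf abs sN])
  define g where "g x = enn2real (f x)" for x
  show thesis
  proof
    show gm[measurable]: "g \<in> borel_measurable borel" unfolding g_def by measurable
    show "0 \<le> g x" for x by (simp add: g_def)
    fix a b :: real assume "a \<le> b"
    have "ennreal (F b - F a) = emeasure ?N {a..b}"
      using emeasure_interval_measure_Icc[OF \<open>a \<le> b\<close> _ contF] monoD[OF mono] by simp
    also have "\<dots> = (\<integral>\<^sup>+x. f x * indicator {a..b} x \<partial>lborel)"
      by (subst dens[symmetric], subst emeasure_density) auto
    also have "\<dots> = (\<integral>\<^sup>+x. ennreal (indicator {a..b} x *\<^sub>R g x) \<partial>lborel)"
      using fin by (intro nn_integral_cong_AE) (auto simp: g_def indicator_def top.not_eq_extremum)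
    finally have "((\<lambda>x. indicator {a..b} x *\<^sub>R g x) has_integral (F b - F a)) UNIV"
      using monoD[OF mono \<open>a \<le> b\<close>] by (intro nn_integral_has_integral) (auto simp: g_def indicator_def)
    moreover have "(\<lambda>x. indicator {a..b} x *\<^sub>R g x) = (\<lambda>x. if x \<in> {a..b} then g x else 0)"
      by (auto simp: indicator_def)
    ultimately show "(g has_integral F b - F a) {a..b}"
      using has_integral_restrict_UNIV by metis
  qed
qed

text \<open>Lebesgue differentiation: where the difference quotients of the indefinite integral stay
  away from \<open>g\<close>, the Vitali theorem selects disjoint intervals, and the Henstock lemma bounds
  the total length of any finitely many of them.\<close>

lemma negligible_not_derivative_of_indefinite_integral:
  fixes F g :: "real \<Rightarrow> real"
  assumes gF: "\<And>a b. a \<le> b \<Longrightarrow> (g has_integral F b - F a) {a..b}"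
  shows "negligible {x. \<not> (F has_real_derivative g x) (at x)}"
proof -
  define dev where "dev x u v = \<bar>F v - F u - g x * (v - u)\<bar>" for x u v
  \<comment> \<open>Failure of differentiability is tested on intervals having \<open>x\<close> as
    an endpoint, so that \<open>x\<close> can be their tag. The number \<open>m\<close> has two
    roles: it bounds the position of \<open>x\<close>, which places everything in one compact
    interval, and 1/m is the size of the failure.\<close>
  define bad where "bad m = {x \<in> {- real m<..<real m}. \<forall>d>0. \<exists>u v. u < v \<and> v - u < d \<and>
     (x = u \<or> x = v) \<and> v - u < real m * dev x u v}" for m :: nat
  have neg: "negligible (bad m)" if "m \<ge> 1" for m
    unfolding negligible_outer_le
  proof (intro allI impI)
    fix e :: real assume "0 < e"
    have m: "0 < real m" using \<open>m \<ge> 1\<close> by simp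
    have int: "g integrable_on cbox (- real m) (real m)"
      using gF[of "- real m" "real m"] by (auto simp: has_integral_integrable)
    \<comment> \<open>Selected intervals satisfy v - u < m * dev, hence a Henstock bound e/m on the
      sum of the deviations bounds their total length by \<open>e\<close>.\<close>
    have "0 < e / real m" using \<open>0 < e\<close> m by simp
    then obtain \<gamma> where \<gamma>: "gauge \<gamma>"
      and hen: "\<forall>p. p tagged_partial_division_of cbox (- real m) (real m) \<longrightarrow> \<gamma> fine p \<longrightarrow>
             (\<Sum>(x,k)\<in>p. norm (measure lborel k *\<^sub>R g x - integral k g)) < e / real m"
      by (rule Henstock_lemma[OF int]) (rule that, assumption, blast)
    define J where "J = {(x,u,v). x \<in> bad m \<and> u < v \<and> (x = u \<or> x = v) \<and> {u..v} \<subseteq> \<gamma> x \<and>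
        {u..v} \<subseteq> {- real m..real m} \<and> v - u < real m * dev x u v}"
    \<comment> \<open>The covering theorem is formulated for balls: {u..v} becomes the closed ball
      around its midpoint, while the tag \<open>x\<close> stays an endpoint and is carried along in
      the triple.\<close>
    define a :: "real \<times> real \<times> real \<Rightarrow> real" where "a = (\<lambda>(x,u,v). (u + v) / 2)"
    define r :: "real \<times> real \<times> real \<Rightarrow> real" where "r = (\<lambda>(x,u,v). (v - u) / 2)"
    have cb: "cball (a (x,u,v)) (r (x,u,v)) = {u..v}" for x u v
      by (auto simp: a_def r_def cball_def dist_real_def abs_if field_simps split: if_splits)
    have rpos: "0 < r i" if "i \<in> J" for i
      using that by (auto simp: J_def r_def)
    have cover: "\<exists>i. i \<in> J \<and> x \<in> cball (a i) (r i) \<and> r i < d" if xd: "x \<in> bad m" "0 < d" for x d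
    proof -
      have "open (\<gamma> x \<inter> {- real m<..<real m})" "x \<in> \<gamma> x \<inter> {- real m<..<real m}"
        using \<gamma> xd(1) by (auto simp: gauge_def bad_def)
      then obtain \<delta> where "\<delta> > 0" and \<delta>: "ball x \<delta> \<subseteq> \<gamma> x \<inter> {- real m<..<real m}"
        unfolding open_contains_ball by blast
      have "0 < min \<delta> d" using \<open>\<delta> > 0\<close> xd by simp
      then obtain u v where uv: "u < v" "v - u < min \<delta> d" "x = u \<or> x = v" "v - u < real m * dev x u v"
        using xd(1) unfolding bad_def by blast
      have "{u..v} \<subseteq> ball x \<delta>" using uv(1-3) by (auto simp: dist_real_def)
      with \<delta> have "{u..v} \<subseteq> \<gamma> x \<inter> {- real m<..<real m}" by (rule order_trans[rotated])
      then have "{u..v} \<subseteq> \<gamma> x" "{u..v} \<subseteq> {- real m..real m}"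
        using greaterThanLessThan_subseteq_atLeastAtMost_iff[of "- real m" "real m" "- real m" "real m"] by blast+
      then have "(x,u,v) \<in> J" unfolding J_def using uv(1,3,4) xd(1) by blast
      moreover have "x \<in> {u..v}" "r (x,u,v) < d" using uv by (auto simp: r_def)
      ultimately show ?thesis using cb by blast
    qed
    obtain C where C: "countable C" "C \<subseteq> J"
      "pairwise (\<lambda>i j. disjnt (cball (a i) (r i)) (cball (a j) (r j))) C"
      "negligible (bad m - (\<Union>i\<in>C. cball (a i) (r i)))"
      by (rule Vitali_covering_theorem_cballs[of J r "bad m" a, OF rpos cover]) (assumption | rule that)+
    define U where "U = (\<Union>i\<in>C. cball (a i) (r i))"
    have fin: "emeasure lebesgue (\<Union>D') \<le> ennreal e"
      if D': "finite D'" "D' \<subseteq> (\<lambda>i. cball (a i) (r i)) ` C" for D'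
    proof -
      obtain C' where C': "finite C'" "C' \<subseteq> C" "D' = (\<lambda>i. cball (a i) (r i)) ` C'"
        using finite_subset_image[OF D'] by blast
      have CJ: "x \<in> bad m" "u < v" "x = u \<or> x = v" "{u..v} \<subseteq> \<gamma> x"
        "{u..v} \<subseteq> {- real m..real m}" "v - u < real m * dev x u v" if "(x,u,v) \<in> C'" for x u v
        using that C' C(2) by (auto simp: J_def)
      have disj: "{u..v} \<inter> {u'..v'} = {}" if "(x,u,v) \<in> C'" "(x',u',v') \<in> C'" "(x,u,v) \<noteq> (x',u',v')"
        for x u v x' u' v'
        using C(3) that C'(2) unfolding pairwise_def disjnt_def by (metis cb subsetD)
      define h :: "real \<times> real \<times> real \<Rightarrow> real \<times> real set" where "h = (\<lambda>(x,u,v). (x, {u..v}))"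
      \<comment> \<open>The intervals of distinct triples are disjoint and nonempty, so no term of
        the Henstock sum is lost on passing to pairs of tag and interval.\<close>
      have inj: "inj_on h C'"
      proof (rule inj_onI)
        fix i j assume ij: "i \<in> C'" "j \<in> C'" "h i = h j"
        obtain x u v x' u' v' where eq: "i = (x,u,v)" "j = (x',u',v')" by (metis prod_cases3)
        then have "{u..v} = {u'..v'}" "u < v" using ij CJ(2) by (auto simp: h_def)
        then have "{u..v} \<inter> {u'..v'} \<noteq> {}" by auto
        then show "i = j" using disj ij eq by blast
      qed
      have part: "h ` C' tagged_partial_division_of cbox (- real m) (real m)"
        unfolding tagged_partial_division_of_def
      proof (intro conjI allI impI)
        show "finite (h ` C')" using C' by simp
      next
        fix x K assume "(x, K) \<in> h ` C'"
        then obtain u v where uv: "(x,u,v) \<in> C'" "K = {u..v}" by (auto simp: h_def)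
        show "x \<in> K" "K \<subseteq> cbox (- real m) (real m)" "\<exists>a b. K = cbox a b"
          using CJ[OF uv(1)] uv(2) by (auto simp: cbox_interval)
      next
        fix x1 K1 x2 K2 assume *: "(x1, K1) \<in> h ` C' \<and> (x2, K2) \<in> h ` C' \<and> (x1, K1) \<noteq> (x2, K2)"
        then obtain u1 v1 u2 v2 where uv: "(x1,u1,v1) \<in> C'" "K1 = {u1..v1}" "(x2,u2,v2) \<in> C'" "K2 = {u2..v2}"
          by (auto simp: h_def)
        then have "K1 \<inter> K2 = {}" using disj[OF uv(1,3)] * by auto
        then show "interior K1 \<inter> interior K2 = {}" using interior_subset by blast
      qed
      have fine: "\<gamma> fine h ` C'"
        using CJ(4) by (auto simp: fine_def h_def)
      have dev_eq: "(\<Sum>(x,k)\<in>h ` C'. norm (measure lborel k *\<^sub>R g x - integral k g)) = (\<Sum>(x,u,v)\<in>C'. dev x u v)"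
      proof (subst sum.reindex[OF inj], rule sum.cong[OF refl])
        fix i assume i: "i \<in> C'"
        obtain x u v where eq: "i = (x,u,v)" by (metis prod_cases3)
        have "u < v" using CJ(2) i eq by blast
        then have "integral {u..v} g = F v - F u" using gF[of u v] by (simp add: integral_unique)
        then show "((\<lambda>(x, k). norm (measure lborel k *\<^sub>R g x - integral k g)) \<circ> h) i = (case i of (x,u,v) \<Rightarrow> dev x u v)"
          using \<open>u < v\<close> by (simp add: eq h_def dev_def algebra_simps abs_minus_commute)
      qed
      have hen': "(\<Sum>(x,u,v)\<in>C'. dev x u v) < e / real m"
        using hen[rule_format, OF part fine] by (simp only: dev_eq)
      have "emeasure lebesgue (\<Union>D') \<le> (\<Sum>i\<in>C'. emeasure lebesgue (cball (a i) (r i)))"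
        unfolding C'(3) using C'(1) by (intro emeasure_subadditive_finite) auto
      also have "\<dots> = (\<Sum>i\<in>C'. ennreal (case i of (x,u,v) \<Rightarrow> v - u))"
      proof (rule sum.cong[OF refl])
        fix i assume i: "i \<in> C'"
        obtain x u v where eq: "i = (x,u,v)" by (metis prod_cases3)
        have "u < v" using CJ(2) i eq by blast
        then show "emeasure lebesgue (cball (a i) (r i)) = ennreal (case i of (x,u,v) \<Rightarrow> v - u)"
          unfolding eq cb by simp
      qed
      also have "\<dots> = ennreal (\<Sum>(x,u,v)\<in>C'. v - u)"
        using CJ(2) by (intro sum_ennreal) (auto simp: less_imp_le)
      also have "(\<Sum>(x,u,v)\<in>C'. v - u) \<le> (\<Sum>(x,u,v)\<in>C'. real m * dev x u v)"
        using CJ(6) by (intro sum_mono) (auto simp: less_imp_le)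
      also have "\<dots> = real m * (\<Sum>(x,u,v)\<in>C'. dev x u v)"
        by (simp add: sum_distrib_left split_def)
      also have "\<dots> \<le> e" using hen' m by (simp add: field_simps)
      finally show ?thesis by (simp add: ennreal_leI)
    qed
    have U_le: "emeasure lebesgue U \<le> ennreal e"
      unfolding U_def
      by (rule emeasure_countable_Union_le[OF _ _ fin]) (use C(1) in auto)
    have "U \<in> sets lebesgue" unfolding U_def using C(1) by (intro sets.countable_UN'') auto
    moreover have "emeasure lebesgue U < \<infinity>"
      using U_le by (rule le_less_trans) simp
    ultimately have "U \<in> lmeasurable" by (rule fmeasurableI)
    moreover from this have "measure lebesgue U \<le> e"
      using U_le \<open>0 < e\<close> by (simp add: emeasure_eq_measure2 fmeasurableD2)
    ultimately have U: "U \<in> lmeasurable" "measure lebesgue U \<le> e" by auto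
    \<comment> \<open>The Vitali intervals cover \<open>bad m\<close> only up to a null set; that
      remainder is added to obtain a genuine cover.\<close>
    let ?T = "(bad m - U) \<union> U"
    have n: "negligible (bad m - U)" using C(4) by (simp add: U_def)
    have "measure lebesgue ?T \<le> measure lebesgue (bad m - U) + measure lebesgue U"
      using n U negligible_imp_measurable by (intro measure_Un_le) auto
    then have "measure lebesgue ?T \<le> e" using U n by (simp add: negligible_imp_measure0)
    moreover have "?T \<in> lmeasurable" using n U negligible_imp_measurable by (intro fmeasurable.Un)
    ultimately show "\<exists>T. bad m \<subseteq> T \<and> T \<in> lmeasurable \<and> measure lebesgue T \<le> e"
      by (intro exI[of _ ?T]) auto
  qed
  have "{x. \<not> (F has_real_derivative g x) (at x)} \<subseteq> (\<Union>m. bad (Suc m))"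
  proof (rule subsetI, rule ccontr)
    fix x assume x: "x \<in> {x. \<not> (F has_real_derivative g x) (at x)}" and nb: "x \<notin> (\<Union>m. bad (Suc m))"
    have "(F has_real_derivative g x) (at x)"
      unfolding has_field_derivative_def has_derivative_within_alt
    proof (intro conjI allI impI bounded_linear_mult_right)
      fix e :: real assume "0 < e"
      \<comment> \<open>One \<open>m\<close> has to exceed both |x|, for x to lie in the range of
        \<open>bad\<close>, and 1/e, for the tolerated deviation to be below
        \<open>e\<close>.\<close>
      obtain m :: nat where m: "max \<bar>x\<bar> (1/e) < real m" using reals_Archimedean2 by blast
      have "x \<notin> bad (Suc m)" using nb by blast
      moreover have "x \<in> {- real (Suc m)<..<real (Suc m)}" using m by auto
      ultimately obtain d where "d > 0" and d: "\<forall>u v. u < v \<and> v - u < d \<and> (x = u \<or> x = v) \<longrightarrow>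
          \<not> v - u < real (Suc m) * dev x u v"
        unfolding bad_def by blast
      have "1 / real (Suc m) \<le> e" using m \<open>0 < e\<close> by (simp add: field_simps)
      have key: "dev x u v \<le> e * (v - u)" if "u < v" "v - u < d" "x = u \<or> x = v" for u v
      proof -
        have "dev x u v \<le> 1 / real (Suc m) * (v - u)" using d that by (simp add: field_simps not_less)
        also have "\<dots> \<le> e * (v - u)" using that \<open>1 / real (Suc m) \<le> e\<close> by (intro mult_right_mono) auto
        finally show ?thesis .
      qed
      show "\<exists>d>0. \<forall>y\<in>UNIV. norm (y - x) < d \<longrightarrow> norm (F y - F x - g x * (y - x)) \<le> e * norm (y - x)"
      proof (intro exI[of _ d] conjI \<open>d > 0\<close> ballI impI)
        fix y assume y: "norm (y - x) < d"
        show "norm (F y - F x - g x * (y - x)) \<le> e * norm (y - x)"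
          using key[of x y] key[of y x] y
          by (cases x y rule: linorder_cases) (auto simp: dev_def abs_if algebra_simps split: if_splits)
      qed
    qed
    then show False using x by simp
  qed
  moreover have "negligible (\<Union>m. bad (Suc m))"
    using neg by (intro negligible_countable_Union) auto
  ultimately show ?thesis using negligible_subset by blast
qed

text \<open>Write f as V - (V - f) with V the variation. Both terms are monotone and absolutely
  continuous, so both have nonnegative densities, and bounded variation makes these integrable over
  the whole line. Differentiability a.e. is then deduced for \<open>f\<close> directly from the
  difference of the densities.\<close>

lemma AC_BV_integrable_derivative:
  assumes ac: "AC_loc f" and bv: "bounded_variation f"
  obtains g where "integrable lborel g" "g \<in> borel_measurable borel"
    "\<And>a b. a \<le> b \<Longrightarrow> (g has_integral f b - f a) {a..b}"
    "AE x in lebesgue. (f has_real_derivative g x) (at x)"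
proof -
  let ?V = "variation_upto f"
  let ?W = "\<lambda>x. ?V x - f x"
  have inc: "\<bar>f y - f x\<bar> \<le> ?V y - ?V x" if "x \<le> y" for x y
    by (rule variation_upto_increment_ge[OF bv that])
  have monoV: "mono ?V" by (rule monoI) (use inc in fastforce)
  have monoW: "mono ?W" by (rule monoI) (use inc in fastforce)
  have acV: "AC_loc ?V"
    using ac abs_cont_on_variation_upto[OF bv] by (simp add: AC_loc_def)
  then have acW: "AC_loc ?W"
    using ac abs_cont_on_diff by (simp add: AC_loc_def)
  obtain B where B: "\<And>t. 0 \<le> ?V t" "\<And>t. ?V t \<le> B"
    using variation_upto_bounds[OF bv] by metis
  \<comment> \<open>Monotone convergence along [-n, n]: the integral of \<open>g\<close> there is an
    increment of \<open>F\<close>, and all increments are bounded by 2 * B.\<close>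
  have integrable: "integrable lborel g"
    if g: "g \<in> borel_measurable borel" "\<And>x. 0 \<le> g x" "\<And>a b. a \<le> b \<Longrightarrow> (g has_integral F b - F a) {a..b}"
      and F: "\<And>a b. a \<le> b \<Longrightarrow> F b - F a \<le> 2 * B" for g F :: "real \<Rightarrow> real"
  proof -
    note [measurable] = g(1)
    have "(\<integral>\<^sup>+x. ennreal (g x) * indicator {- real n..real n} x \<partial>lborel) \<le> ennreal (2 * B)" for n
    proof -
      have "((\<lambda>x. g x * indicator {- real n..real n} x) has_integral F n - F (- real n)) UNIV"
      proof -
        have "(\<lambda>x. g x * indicator {- real n..real n} x) = (\<lambda>x. if x \<in> {- real n..real n} then g x else 0)"
          by (auto simp: indicator_def)
        then show ?thesis
          by (simp only: has_integral_restrict_UNIV) (simp add: g(3))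
      qed
      then have "(\<integral>\<^sup>+x. ennreal (g x * indicator {- real n..real n} x) \<partial>lborel) = F n - F (- real n)"
        using g(2) by (intro nn_integral_has_integral_lborel) auto
      also have "(\<integral>\<^sup>+x. ennreal (g x * indicator {- real n..real n} x) \<partial>lborel)
          = (\<integral>\<^sup>+x. ennreal (g x) * indicator {- real n..real n} x \<partial>lborel)"
        by (intro nn_integral_cong) (auto simp: indicator_def)
      finally show ?thesis using F[of "- real n" "real n"] by (simp add: ennreal_leI)
    qed
    moreover have "(SUP n. \<integral>\<^sup>+x. ennreal (g x) * indicator {- real n..real n} x \<partial>lborel)
       = (\<integral>\<^sup>+x. (SUP n. ennreal (g x) * indicator {- real n..real n} x) \<partial>lborel)"
      by (intro nn_integral_monotone_convergence_SUP[symmetric])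
         (auto simp: incseq_def le_fun_def intro!: mult_left_mono indicator_leI)
    moreover have "(SUP n. ennreal (g x) * indicator {- real n..real n} x) = ennreal (g x)" for x
    proof (rule antisym)
      show "(SUP n. ennreal (g x) * indicator {- real n..real n} x) \<le> ennreal (g x)"
        by (intro SUP_least) (auto simp: indicator_def)
      obtain n :: nat where "\<bar>x\<bar> \<le> real n" using real_arch_simple by blast
      then have "x \<in> {- real n..real n}" by auto
      then have "ennreal (g x) = ennreal (g x) * indicator {- real n..real n} x" by simp
      then show "ennreal (g x) \<le> (SUP n. ennreal (g x) * indicator {- real n..real n} x)"
        by (metis (no_types, lifting) SUP_upper UNIV_I)
    qed
    ultimately have "(\<integral>\<^sup>+x. ennreal (g x) \<partial>lborel) \<le> ennreal (2 * B)"
      by (metis (no_types, lifting) SUP_least nn_integral_cong)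
    then show ?thesis
      using g(2) by (intro integrableI_bounded) (auto intro: le_less_trans)
  qed
  obtain g1 where g1: "g1 \<in> borel_measurable borel" "\<And>x. 0 \<le> g1 x"
    "\<And>a b. a \<le> b \<Longrightarrow> (g1 has_integral ?V b - ?V a) {a..b}"
    using mono_AC_has_integral[OF monoV acV] by metis
  obtain g2 where g2: "g2 \<in> borel_measurable borel" "\<And>x. 0 \<le> g2 x"
    "\<And>a b. a \<le> b \<Longrightarrow> (g2 has_integral ?W b - ?W a) {a..b}"
    using mono_AC_has_integral[OF monoW acW] by metis
  let ?g = "\<lambda>x. g1 x - g2 x"
  have int: "(?g has_integral f b - f a) {a..b}" if "a \<le> b" for a b
    using has_integral_diff[OF g1(3)[OF that] g2(3)[OF that]] by simp
  show thesis
  proof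
    have "B \<ge> 0" using B[of 0] by linarith
    have "?V b - ?V a \<le> 2 * B" for a b
      using B(1)[of a] B(2)[of b] \<open>B \<ge> 0\<close> by linarith
    then have "integrable lborel g1"
      by (intro integrable[OF g1])
    \<comment> \<open>The increment of \<open>f\<close> is at most that of V in absolute value, so
      that of V - f is at most twice that of V. This is where the factor 2 in 2 * B comes
      from.\<close>
    moreover have "?W b - ?W a \<le> 2 * B" if "a \<le> b" for a b
      using B(1)[of a] B(2)[of b] inc[OF that] by linarith
    then have "integrable lborel g2"
      by (intro integrable[OF g2])
    ultimately show "integrable lborel ?g" by simp
    show "?g \<in> borel_measurable borel" using g1 g2 by simp
    show "(?g has_integral f b - f a) {a..b}" if "a \<le> b" for a b by (rule int[OF that])
    have "negligible {x. \<not> (f has_real_derivative ?g x) (at x)}"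
      by (rule negligible_not_derivative_of_indefinite_integral[OF int])
    then show "AE x in lebesgue. (f has_real_derivative ?g x) (at x)"
      unfolding eventually_ae_filter_negligible by blast
  qed
qed

section \<open>Integration by parts against the Fourier kernel\<close>

abbreviation fker :: "real \<Rightarrow> real \<Rightarrow> complex" where
  "fker s x \<equiv> exp (- (\<i> * complex_of_real (s * x)))"

lemma norm_fker [simp]: "norm (fker s x) = 1"
  using norm_exp_i_times[of "- (s * x)"] by simp

lemma fker_vector_derivative:
  "(fker s has_vector_derivative - (\<i> * of_real s) * fker s x) (at x within S)"
  unfolding of_real_mult
  by (auto intro!: derivative_eq_intros has_vector_derivative_real_field)

lemma continuous_on_fker [continuous_intros]: "continuous_on S (fker s)"
  by (intro continuous_intros)

lemma borel_measurable_fker [measurable]: "fker s \<in> borel_measurable borel"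
  by (intro borel_measurable_continuous_onI continuous_on_fker)

lemma integrable_fker_mult:
  assumes "integrable M f" "fker s \<in> borel_measurable M"
  shows "integrable M (\<lambda>x. fker s x * f x)"
proof (rule Bochner_Integration.integrable_bound[OF assms(1)])
  show "(\<lambda>x. fker s x * f x) \<in> borel_measurable M"
    using borel_measurable_times[OF assms(2) borel_measurable_integrable[OF assms(1)]] .
qed (simp add: norm_mult)

text \<open>Tonelli's theorem for a majorant that is a product. Each exchange of Bochner integrals
  below concerns a kernel dominated in this way.\<close>

lemma integrable_lborel_pair_bound:
  fixes K :: "real \<times> real \<Rightarrow> 'b::{banach, second_countable_topology}"
    and f :: "real \<Rightarrow> 'c::{banach, second_countable_topology}"
    and h :: "real \<Rightarrow> 'd::{banach, second_countable_topology}"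
  assumes f: "integrable lborel f" and h: "integrable lborel h"
    and K: "K \<in> borel_measurable (borel \<Otimes>\<^sub>M borel)"
    and bound: "\<And>x y. norm (K (x, y)) \<le> norm (f x) * norm (h y)"
  shows "integrable (lborel \<Otimes>\<^sub>M lborel) K"
proof (rule integrableI_bounded)
  have "sets (lborel \<Otimes>\<^sub>M lborel :: (real \<times> real) measure) = sets (borel \<Otimes>\<^sub>M borel)"
    by (rule sets_pair_measure_cong) simp_all
  with K show K'[measurable]: "K \<in> borel_measurable (lborel \<Otimes>\<^sub>M lborel)"
    using measurable_cong_sets by blast
  note [measurable] = borel_measurable_integrable[OF f] borel_measurable_integrable[OF h]
  have "(\<integral>\<^sup>+p. norm (K p) \<partial>(lborel \<Otimes>\<^sub>M lborel)) = (\<integral>\<^sup>+x. \<integral>\<^sup>+y. norm (K (x, y)) \<partial>lborel \<partial>lborel)"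
    by (rule lborel.nn_integral_fst[symmetric]) simp
  also have "\<dots> \<le> (\<integral>\<^sup>+x. \<integral>\<^sup>+y. ennreal (norm (f x)) * ennreal (norm (h y)) \<partial>lborel \<partial>lborel)"
    using bound by (intro nn_integral_mono) (simp add: ennreal_mult[symmetric])
  also have "\<dots> = (\<integral>\<^sup>+x. ennreal (norm (f x)) \<partial>lborel) * (\<integral>\<^sup>+y. ennreal (norm (h y)) \<partial>lborel)"
    by (simp add: nn_integral_cmult nn_integral_multc)
  also have "\<dots> < \<infinity>"
    using f h by (simp add: integrable_iff_bounded ennreal_mult_less_top)
  finally show "(\<integral>\<^sup>+p. norm (K p) \<partial>(lborel \<Otimes>\<^sub>M lborel)) < \<infinity>" .
qed

lemma lborel_Fubini_swap:
  fixes f :: "real \<Rightarrow> real \<Rightarrow> 'b::{banach, second_countable_topology}"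
  assumes "integrable (lborel \<Otimes>\<^sub>M lborel) (\<lambda>(x, y). f x y)"
  shows "(\<integral>x. \<integral>y. f x y \<partial>lborel \<partial>lborel) = (\<integral>y. \<integral>x. f x y \<partial>lborel \<partial>lborel)"
  using pair_sigma_finite.Fubini_integral[of lborel lborel f] assms
  by (simp add: pair_sigma_finite_def sigma_finite_lborel)

lemma lborel_integral_eq_integral:
  fixes f :: "real \<Rightarrow> 'b::euclidean_space"
  assumes "set_integrable lborel S f"
  shows "(\<integral>x. indicator S x *\<^sub>R f x \<partial>lborel) = integral S f"
  using set_borel_integral_eq_integral(2)[OF assms] by (simp add: set_lebesgue_integral_def)

lemma fker_integral:
  assumes "a \<le> b"
  shows "integral {a..b} (\<lambda>x. - (\<i> * of_real s) * fker s x) = fker s b - fker s a"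
  by (intro integral_unique fundamental_theorem_of_calculus assms fker_vector_derivative)

text \<open>Here \<open>g\<close> is known as a density of \<phi>, not as a pointwise derivative, so
  the formula comes from Fubini on the triangle a <= t <= x <= b: integrating E'(x) g(t) over t
  first produces the increment of \<phi>, over x first the increment of the kernel E.\<close>

lemma integral_by_parts_fker:
  fixes \<phi> g :: "real \<Rightarrow> real"
  assumes g: "integrable lborel g"
    and g\<phi>: "\<And>a b. a \<le> b \<Longrightarrow> (g has_integral \<phi> b - \<phi> a) {a..b}"
    and cont: "continuous_on UNIV \<phi>"
    and "a \<le> b"
  shows "- (\<i> * of_real s) * integral {a..b} (\<lambda>x. fker s x * of_real (\<phi> x))
     = fker s b * of_real (\<phi> b) - fker s a * of_real (\<phi> a) - integral {a..b} (\<lambda>x. fker s x * of_real (g x))"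
proof -
  note [measurable] = borel_measurable_integrable[OF g]
  let ?E' = "\<lambda>x. - (\<i> * of_real s) * fker s x"
  \<comment> \<open>Extension by zero outside the triangle lets both iterated integrals run over the
    whole line.\<close>
  define K where "K x t = (if a \<le> t \<and> t \<le> x \<and> x \<le> b then ?E' x * of_real (g t) else 0)" for x t
  have gc: "integrable lborel (\<lambda>x. complex_of_real (g x))" using g by (rule integrable_of_real)
  have set_g: "set_integrable lborel S (\<lambda>t. complex_of_real (g t))" if "S \<in> sets borel" for S
    using gc that unfolding set_integrable_def by (intro integrable_mult_indicator) auto
  have E'_int: "set_integrable lborel {u..v} ?E'" for u v
    by (intro borel_integrable_atLeastAtMost' continuous_intros)
  have K_int: "integrable (lborel \<Otimes>\<^sub>M lborel) (\<lambda>(x, t). K x t)"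
  proof (rule integrable_lborel_pair_bound)
    show "integrable lborel (\<lambda>x. indicator {a..b} x *\<^sub>R ?E' x)"
      using E'_int unfolding set_integrable_def .
    show "integrable lborel g" by (rule g)
    show "(\<lambda>(x, t). K x t) \<in> borel_measurable (borel \<Otimes>\<^sub>M borel)"
      unfolding K_def split_def by measurable
    show "norm (case (x, t) of (x, t) \<Rightarrow> K x t) \<le> norm (indicator {a..b} x *\<^sub>R ?E' x) * norm (g t)" for x t
      by (auto simp: K_def norm_mult indicator_def)
  qed
  have inner1: "(\<integral>t. K x t \<partial>lborel) = indicator {a..b} x *\<^sub>R (?E' x * of_real (\<phi> x - \<phi> a))" for x
  proof (cases "x \<in> {a..b}")
    case True
    have "(\<integral>t. K x t \<partial>lborel) = (\<integral>t. ?E' x * (indicator {a..x} t *\<^sub>R of_real (g t)) \<partial>lborel)"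
      using True by (intro Bochner_Integration.integral_cong) (auto simp: K_def indicator_def)
    also have "\<dots> = ?E' x * (\<integral>t. indicator {a..x} t *\<^sub>R of_real (g t) \<partial>lborel)"
      by (rule integral_mult_right_zero)
    also have "(\<integral>t. indicator {a..x} t *\<^sub>R of_real (g t) \<partial>lborel) = integral {a..x} (\<lambda>t. complex_of_real (g t))"
      by (rule lborel_integral_eq_integral[OF set_g]) simp
    also have "\<dots> = of_real (\<phi> x - \<phi> a)"
      using g\<phi>[of a x] True by (intro integral_unique has_integral_of_real) auto
    finally show ?thesis using True by simp
  next
    case False
    then have "K x t = 0" for t by (auto simp: K_def)
    then show ?thesis using False by simp
  qed
  have inner2: "(\<integral>x. K x t \<partial>lborel) = indicator {a..b} t *\<^sub>R (of_real (g t) * (fker s b - fker s t))" for t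
  proof (cases "t \<in> {a..b}")
    case True
    have "(\<integral>x. K x t \<partial>lborel) = (\<integral>x. of_real (g t) * (indicator {t..b} x *\<^sub>R ?E' x) \<partial>lborel)"
      using True by (intro Bochner_Integration.integral_cong) (auto simp: K_def indicator_def)
    also have "\<dots> = of_real (g t) * (\<integral>x. indicator {t..b} x *\<^sub>R ?E' x \<partial>lborel)"
      by (rule integral_mult_right_zero)
    also have "(\<integral>x. indicator {t..b} x *\<^sub>R ?E' x \<partial>lborel) = fker s b - fker s t"
      using True by (subst lborel_integral_eq_integral[OF E'_int]) (rule fker_integral, simp)
    finally show ?thesis using True by simp
  next
    case False
    then have "K x t = 0" for x by (auto simp: K_def)
    then show ?thesis using False by simp
  qed
  have cont': "continuous_on {a..b} \<phi>" using cont by (rule continuous_on_subset) simp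
  have "integral {a..b} (\<lambda>x. ?E' x * of_real (\<phi> x - \<phi> a)) = (\<integral>x. \<integral>t. K x t \<partial>lborel \<partial>lborel)"
    unfolding inner1
    by (rule lborel_integral_eq_integral[symmetric])
       (intro borel_integrable_atLeastAtMost' continuous_intros cont')
  also have "\<dots> = (\<integral>t. \<integral>x. K x t \<partial>lborel \<partial>lborel)"
    by (rule lborel_Fubini_swap[OF K_int])
  also have "\<dots> = integral {a..b} (\<lambda>t. of_real (g t) * (fker s b - fker s t))"
    unfolding inner2
  proof (rule lborel_integral_eq_integral)
    have "integrable lborel (\<lambda>t. fker s b * (indicator {a..b} t *\<^sub>R complex_of_real (g t)) - fker s t * (indicator {a..b} t *\<^sub>R complex_of_real (g t)))"
      using set_g[of "{a..b}"] unfolding set_integrable_def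
      by (intro Bochner_Integration.integrable_diff integrable_mult_right integrable_fker_mult) auto
    then show "set_integrable lborel {a..b} (\<lambda>t. of_real (g t) * (fker s b - fker s t))"
      unfolding set_integrable_def by (simp add: algebra_simps)
  qed
  also have "\<dots> = fker s b * of_real (\<phi> b - \<phi> a) - integral {a..b} (\<lambda>x. fker s x * of_real (g x))"
  proof (rule integral_unique)
    have "((\<lambda>t. fker s b * of_real (g t)) has_integral fker s b * of_real (\<phi> b - \<phi> a)) {a..b}"
      by (intro has_integral_mult_right has_integral_of_real g\<phi> \<open>a \<le> b\<close>)
    moreover have "(\<lambda>x. fker s x * of_real (g x)) integrable_on {a..b}"
    proof (rule set_borel_integral_eq_integral(1))
      have "integrable lborel (\<lambda>t. indicator {a..b} t *\<^sub>R (fker s t * complex_of_real (g t)))"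
        by (intro integrable_mult_indicator integrable_fker_mult gc) auto
      then show "set_integrable lborel {a..b} (\<lambda>x. fker s x * of_real (g x))"
        unfolding set_integrable_def .
    qed
    ultimately have "((\<lambda>t. fker s b * of_real (g t) - fker s t * of_real (g t)) has_integral
        fker s b * of_real (\<phi> b - \<phi> a) - integral {a..b} (\<lambda>x. fker s x * of_real (g x))) {a..b}"
      by (intro has_integral_diff integrable_integral)
    then show "((\<lambda>t. of_real (g t) * (fker s b - fker s t)) has_integral
        fker s b * of_real (\<phi> b - \<phi> a) - integral {a..b} (\<lambda>x. fker s x * of_real (g x))) {a..b}"
      by (simp add: algebra_simps)
  qed
  finally have 1: "integral {a..b} (\<lambda>x. ?E' x * of_real (\<phi> x - \<phi> a))
    = fker s b * of_real (\<phi> b - \<phi> a) - integral {a..b} (\<lambda>x. fker s x * of_real (g x))" .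
  \<comment> \<open>Fubini produced \<phi> x - \<phi> a. The constant \<phi> a is restored by
    integrating the derivative of the kernel explicitly, which supplies the boundary term at
    \<open>a\<close>.\<close>
  have "integral {a..b} (\<lambda>x. ?E' x * of_real (\<phi> x))
      = integral {a..b} (\<lambda>x. ?E' x * of_real (\<phi> x - \<phi> a) + ?E' x * of_real (\<phi> a))"
    by (simp add: algebra_simps)
  also have "\<dots> = integral {a..b} (\<lambda>x. ?E' x * of_real (\<phi> x - \<phi> a)) + integral {a..b} (\<lambda>x. ?E' x * of_real (\<phi> a))"
    by (intro Henstock_Kurzweil_Integration.integral_add integrable_continuous_real continuous_intros cont')
  also have "integral {a..b} (\<lambda>x. ?E' x * of_real (\<phi> a)) = (fker s b - fker s a) * of_real (\<phi> a)"
    using fker_integral[OF \<open>a \<le> b\<close>, of s] by (subst integral_mult_left) (auto intro!: integrable_continuous_real continuous_intros)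
  also note 1
  finally have "integral {a..b} (\<lambda>x. ?E' x * of_real (\<phi> x)) =
    fker s b * of_real (\<phi> b) - fker s a * of_real (\<phi> a) - integral {a..b} (\<lambda>x. fker s x * of_real (g x))"
    by (simp add: algebra_simps)
  moreover have "integral {a..b} (\<lambda>x. ?E' x * of_real (\<phi> x))
    = - (\<i> * of_real s) * integral {a..b} (\<lambda>x. fker s x * of_real (\<phi> x))"
    unfolding mult.assoc by (rule integral_mult_right)
  ultimately show ?thesis by simp
qed

text \<open>After integration by parts the boundary terms vanish with \<phi> at both ends, and what
  remains is absolutely convergent. The HK integral over the line asks for a limit over all [a, b]
  containing a large ball, so both endpoints move independently.\<close>

lemma has_integral_fker_UNIV:
  fixes \<phi> g :: "real \<Rightarrow> real"
  assumes g: "integrable lborel g"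
    and g\<phi>: "\<And>a b. a \<le> b \<Longrightarrow> (g has_integral \<phi> b - \<phi> a) {a..b}"
    and cont: "continuous_on UNIV \<phi>"
    and top: "(\<phi> \<longlongrightarrow> 0) at_top" and bot: "(\<phi> \<longlongrightarrow> 0) at_bot"
    and "s \<noteq> 0"
  shows "((\<lambda>x. fker s x * of_real (\<phi> x)) has_integral
      - (\<i> / of_real s) * (\<integral>x. fker s x * of_real (g x) \<partial>lborel)) UNIV"
proof -
  let ?G = "\<integral>x. fker s x * of_real (g x) \<partial>lborel"
  have "integrable lborel (\<lambda>x. fker s x * complex_of_real (g x))"
    by (intro integrable_fker_mult integrable_of_real g) auto
  then have "((\<lambda>x. fker s x * of_real (g x)) has_integral ?G) UNIV"
    by (rule has_integral_integral_lborel)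
  then have G: "\<forall>e>0. \<exists>B>0. \<forall>a b. ball 0 B \<subseteq> cbox a b \<longrightarrow>
            norm (integral (cbox a b) (\<lambda>x. fker s x * of_real (g x)) - ?G) < e"
    unfolding has_integral_alt' by simp
  have parts: "integral {a..b} (\<lambda>x. fker s x * of_real (\<phi> x))
     = (\<i> / of_real s) * (fker s b * of_real (\<phi> b) - fker s a * of_real (\<phi> a) - integral {a..b} (\<lambda>x. fker s x * of_real (g x)))"
    if "a \<le> b" for a b
    using integral_by_parts_fker[OF g g\<phi> cont that, of s] \<open>s \<noteq> 0\<close>
    by (metis (no_types, lifting) divide_minus_left i_squared mult.commute mult_minus_left nonzero_eq_divide_eq
          of_real_eq_0_iff times_divide_eq_left mult.assoc mult.left_commute minus_minus mult_1)
  show ?thesis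
    unfolding has_integral_alt'
  proof (intro conjI allI impI)
    show "(\<lambda>x. if x \<in> UNIV then fker s x * of_real (\<phi> x) else 0) integrable_on cbox a b" for a b
    proof -
      have "continuous_on {a..b} \<phi>" using cont by (rule continuous_on_subset) simp
      then have "(\<lambda>x. fker s x * of_real (\<phi> x)) integrable_on {a..b}"
        by (intro integrable_continuous_real continuous_intros)
      then show ?thesis by (simp add: cbox_interval)
    qed
    fix e :: real assume "0 < e"
    \<comment> \<open>Three errors below \<open>d\<close> occur, two boundary terms and the tail of
      the integral of \<open>g\<close>, and their sum is multiplied by 1/|s|.\<close>
    define d where "d = e * \<bar>s\<bar> / 3"
    have "0 < d" using \<open>0 < e\<close> \<open>s \<noteq> 0\<close> by (simp add: d_def)
    obtain B1 where B1: "B1 > 0" "\<And>a b. ball 0 B1 \<subseteq> cbox a b \<Longrightarrow>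
            norm (integral (cbox a b) (\<lambda>x. fker s x * of_real (g x)) - ?G) < d"
      using G \<open>0 < d\<close> by blast
    have "eventually (\<lambda>x. dist (\<phi> x) 0 < d) at_top" "eventually (\<lambda>x. dist (\<phi> x) 0 < d) at_bot"
      using top bot \<open>0 < d\<close> by (auto dest: tendstoD)
    then obtain T1 T2 where T: "\<And>x. x \<ge> T1 \<Longrightarrow> \<bar>\<phi> x\<bar> < d" "\<And>x. x \<le> T2 \<Longrightarrow> \<bar>\<phi> x\<bar> < d"
      unfolding eventually_at_top_linorder eventually_at_bot_linorder by (auto simp: dist_real_def)
    define B where "B = max B1 (max T1 (- T2))"
    have "B > 0" using B1 by (simp add: B_def)
    show "\<exists>B>0. \<forall>a b. ball 0 B \<subseteq> cbox a b \<longrightarrow>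
            norm (integral (cbox a b) (\<lambda>x. if x \<in> UNIV then fker s x * of_real (\<phi> x) else 0)
               - - (\<i> / of_real s) * ?G) < e"
    proof (intro exI[of _ B] conjI allI impI \<open>B > 0\<close>)
      fix a b :: real assume sub: "ball 0 B \<subseteq> cbox a b"
      have ball: "ball 0 B = {-B<..<B}" by (auto simp: dist_real_def)
      have ab: "a \<le> - B" "B \<le> b"
        using sub \<open>B > 0\<close> unfolding ball by (auto simp: cbox_interval greaterThanLessThan_subseteq_atLeastAtMost_iff)
      have "ball 0 B1 \<subseteq> cbox a b" using sub by (auto simp: B_def)
      then have g1: "norm (integral {a..b} (\<lambda>x. fker s x * of_real (g x)) - ?G) < d"
        using B1(2) by (simp add: cbox_interval)
      have \<phi>ab: "\<bar>\<phi> a\<bar> < d" "\<bar>\<phi> b\<bar> < d" using ab T by (auto simp: B_def)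
      let ?I = "integral {a..b} (\<lambda>x. fker s x * of_real (g x))"
      have "integral (cbox a b) (\<lambda>x. if x \<in> UNIV then fker s x * of_real (\<phi> x) else 0) - - (\<i> / of_real s) * ?G
         = (\<i> / of_real s) * (fker s b * of_real (\<phi> b) - fker s a * of_real (\<phi> a) - (?I - ?G))"
        using parts[of a b] ab \<open>B > 0\<close> by (simp add: cbox_interval algebra_simps)
      also have "norm \<dots> = (1 / \<bar>s\<bar>) * norm (fker s b * of_real (\<phi> b) - fker s a * of_real (\<phi> a) - (?I - ?G))"
        by (simp add: norm_mult norm_divide)
      also have "\<dots> < (1 / \<bar>s\<bar>) * (3 * d)"
      proof (rule mult_strict_left_mono)
        have "norm (fker s b * of_real (\<phi> b) - fker s a * of_real (\<phi> a) - (?I - ?G))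
          \<le> norm (fker s b * of_real (\<phi> b)) + norm (fker s a * of_real (\<phi> a)) + norm (?I - ?G)"
          by (meson norm_triangle_ineq4 add_mono order_refl order_trans)
        also have "\<dots> < 3 * d" using g1 \<phi>ab by (simp add: norm_mult)
        finally show "norm (fker s b * of_real (\<phi> b) - fker s a * of_real (\<phi> a) - (?I - ?G)) < 3 * d" .
      qed (use \<open>s \<noteq> 0\<close> in simp)
      also have "\<dots> = e" using \<open>s \<noteq> 0\<close> by (simp add: d_def)
      finally show "norm (integral (cbox a b) (\<lambda>x. if x \<in> UNIV then fker s x * of_real (\<phi> x) else 0)
               - - (\<i> / of_real s) * ?G) < e" .
    qed
  qed
qed

section \<open>The L2 bound for the Fourier transform\<close>

text \<open>\<open>Lp\<close> refers to \<open>lebesgue\<close>, whereas the double integrals are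
  taken over products of \<open>lborel\<close>; a Borel representative bridges the two.\<close>

lemma lebesgue_measurable_AE_eq_borel_complex:
  fixes h :: "real \<Rightarrow> complex"
  assumes "h \<in> borel_measurable lebesgue"
  obtains h' where "h' \<in> borel_measurable borel" "AE x in lebesgue. h x = h' x"
proof -
  have m: "(\<lambda>x. Re (h x)) \<in> borel_measurable lebesgue" "(\<lambda>x. Im (h x)) \<in> borel_measurable lebesgue"
    using assms by auto
  obtain u v where u: "u \<in> borel_measurable lborel" "AE x in lborel. Re (h x) = u x"
    and v: "v \<in> borel_measurable lborel" "AE x in lborel. Im (h x) = v x"
    using m[THEN completion_ex_borel_measurable_real] by blast
  show thesis
  proof
    show "(\<lambda>x. Complex (u x) (v x)) \<in> borel_measurable borel"
      using u(1) v(1) by (simp add: Complex_eq)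
    show "AE x in lebesgue. h x = Complex (u x) (v x)"
      using u(2)[THEN AE_completion] v(2)[THEN AE_completion] by eventually_elim (simp add: complex_eq_iff)
  qed
qed

lemma Lp_1_iff_integrable: "Lp 1 f \<longleftrightarrow> integrable lebesgue f"
  unfolding Lp_def by (auto simp: integrable_norm_iff)

lemma borel_measurable_fker_lebesgue [measurable]: "fker s \<in> borel_measurable lebesgue"
  using measurable_completion[of "fker s" lborel borel] by simp

lemma continuous_on_Fourier_integral:
  assumes f: "integrable lebesgue f"
  shows "continuous_on UNIV (\<lambda>s. \<integral>x. fker s x * f x \<partial>lebesgue)"
proof (rule continuous_at_imp_continuous_on, intro ballI)
  fix s0 :: real
  show "isCont (\<lambda>s. \<integral>x. fker s x * f x \<partial>lebesgue) s0"
    unfolding continuous_at_sequentially comp_def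
  proof (intro allI impI)
    fix X :: "nat \<Rightarrow> real" assume X: "X \<longlonglongrightarrow> s0"
    show "(\<lambda>n. \<integral>x. fker (X n) x * f x \<partial>lebesgue) \<longlonglongrightarrow> (\<integral>x. fker s0 x * f x \<partial>lebesgue)"
    proof (rule integral_dominated_convergence[where w = "\<lambda>x. norm (f x)"])
      show "(\<lambda>x. fker s0 x * f x) \<in> borel_measurable lebesgue"
        "(\<lambda>x. fker (X n) x * f x) \<in> borel_measurable lebesgue" for n
        by (rule borel_measurable_integrable[OF integrable_fker_mult[OF f borel_measurable_fker_lebesgue]])+
      show "integrable lebesgue (\<lambda>x. norm (f x))" using f by simp
      show "AE x in lebesgue. (\<lambda>n. fker (X n) x * f x) \<longlonglongrightarrow> fker s0 x * f x"
        using X by (auto intro!: tendsto_intros)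
      show "AE x in lebesgue. norm (fker (X n) x * f x) \<le> norm (f x)" for n
        by (simp add: norm_mult)
    qed
  qed
qed

lemma norm_Fourier_integral_le:
  assumes f: "integrable lebesgue f"
  shows "norm (\<integral>x. fker s x * f x \<partial>lebesgue) \<le> (\<integral>x. norm (f x) \<partial>lebesgue)"
  by (rule order_trans[OF integral_norm_bound]) (simp add: norm_mult)

text \<open>The substitution s = n r leads to the characteristic function of the standard normal
  distribution. Writing the result as a multiple of a normal density of deviation 1/n exhibits its
  mass 2 pi.\<close>

lemma Fourier_transform_gaussian:
  assumes "0 < n"
  shows "(\<integral>s. fker s t * of_real (exp (- (s / n)\<^sup>2 / 2)) \<partial>lborel) = of_real (2 * pi * normal_density 0 (1 / n) t)"
proof -
  have "(\<integral>s. fker s t * of_real (exp (- (s / n)\<^sup>2 / 2)) \<partial>lborel)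
     = n *\<^sub>R (\<integral>r. fker (n * r) t * of_real (exp (- r\<^sup>2 / 2)) \<partial>lborel)"
    using assms by (subst lborel_integral_real_affine[where c = n and t = 0]) auto
  also have "(\<integral>r. fker (n * r) t * of_real (exp (- r\<^sup>2 / 2)) \<partial>lborel)
     = (\<integral>r. of_real (sqrt (2 * pi)) * (std_normal_density r *\<^sub>R iexp (- n * t * r)) \<partial>lborel)"
    by (intro Bochner_Integration.integral_cong refl)
       (simp add: std_normal_density_def scaleR_conv_of_real field_simps)
  also have "\<dots> = of_real (sqrt (2 * pi)) * (\<integral>r. std_normal_density r *\<^sub>R iexp (- n * t * r) \<partial>lborel)"
    by (rule integral_mult_right_zero)
  also have "(\<integral>r. std_normal_density r *\<^sub>R iexp (- n * t * r) \<partial>lborel) = char std_normal_distribution (- n * t)"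
    unfolding char_def by (subst integral_density) (auto simp: normal_density_nonneg)
  also have "\<dots> = of_real (exp (- ((n * t)\<^sup>2) / 2))"
    by (simp add: char_std_normal_distribution)
  finally have 1: "(\<integral>s. fker s t * of_real (exp (- (s / n)\<^sup>2 / 2)) \<partial>lborel)
      = of_real (n * (sqrt (2 * pi) * exp (- ((n * t)\<^sup>2) / 2)))"
    by (simp add: scaleR_conv_of_real)
  have "sqrt (2 * pi * (1 / n)\<^sup>2) = sqrt (2 * pi) / n"
    using assms by (simp add: real_sqrt_mult real_sqrt_divide power_divide)
  then have "2 * pi * normal_density 0 (1 / n) t = (2 * pi / sqrt (2 * pi)) * n * exp (- ((n * t)\<^sup>2) / 2)"
    using assms by (simp add: normal_density_def power_mult_distrib power_divide field_simps)
  also have "2 * pi / sqrt (2 * pi) = sqrt (2 * pi)"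
    by (rule real_div_sqrt) simp
  finally show ?thesis unfolding 1 by (simp add: mult_ac)
qed

lemma nn_integral_normal_density:
  assumes "0 < \<sigma>"
  shows "(\<integral>\<^sup>+x. ennreal (normal_density \<mu> \<sigma> x) \<partial>lborel) = 1"
  using assms by (subst nn_integral_eq_integral) (auto simp: integral_normal_density)

text \<open>Gaussian summability turns \<open>\<integral>\<bar>H\<bar>\<^sup>2 w\<close> into a double integral against an approximate
  identity, to which AM-GM applies.\<close>

lemma Fourier_integral_gaussian_L2_bound:
  fixes h :: "real \<Rightarrow> complex"
  assumes h: "integrable lborel h" and hm[measurable]: "h \<in> borel_measurable borel" and "0 < n"
  shows "(\<integral>\<^sup>+s. ennreal ((norm (\<integral>x. fker s x * h x \<partial>lborel))\<^sup>2 * exp (- (s / n)\<^sup>2 / 2)) \<partial>lborel)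
    \<le> ennreal (2 * pi) * (\<integral>\<^sup>+x. ennreal ((norm (h x))\<^sup>2) \<partial>lborel)"
proof -
  define w :: "real \<Rightarrow> real" where "w s = exp (- (s / n)\<^sup>2 / 2)" for s
  define H where "H s = (\<integral>x. fker s x * h x \<partial>lborel)" for s
  define W :: "real \<Rightarrow> real" where "W t = 2 * pi * normal_density 0 (1 / n) t" for t
  have [measurable]: "w \<in> borel_measurable borel" unfolding w_def by measurable
  have [measurable]: "H \<in> borel_measurable borel" unfolding H_def by measurable
  have [measurable]: "W \<in> borel_measurable borel" unfolding W_def by measurable
  have [measurable]: "cnj \<in> borel_measurable borel"
    by (intro borel_measurable_continuous_onI continuous_intros)
  have w_pos: "0 \<le> w s" for s by (simp add: w_def)
  have "integrable lborel (\<lambda>s. n * sqrt (2 * pi) * normal_density 0 n s)"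
    using \<open>0 < n\<close> by simp
  also have "(\<lambda>s. n * sqrt (2 * pi) * normal_density 0 n s) = w"
    using \<open>0 < n\<close> by (auto simp: normal_density_def w_def real_sqrt_mult power_divide)
  finally have w: "integrable lborel w" .
  have W: "(\<integral>s. fker s t * of_real (w s) \<partial>lborel) = of_real (W t)" for t
    unfolding w_def W_def by (rule Fourier_transform_gaussian[OF \<open>0 < n\<close>])
  define C where "C = (\<integral>x. norm (h x) \<partial>lborel)"
  have C_pos: "0 \<le> C" by (simp add: C_def)
  have H_bound: "norm (H s) \<le> C" for s
    unfolding H_def C_def by (rule order_trans[OF integral_norm_bound]) (simp add: norm_mult)
  have Hw: "integrable lborel (\<lambda>s. C * w s)" using w by simp
  have cnj_H: "cnj (H s) = (\<integral>y. fker (- s) y * cnj (h y) \<partial>lborel)" for s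
    unfolding H_def Bochner_Integration.integral_cnj[symmetric] by (simp add: exp_cnj)
  \<comment> \<open>When one factor of |H|^2 = H * cnj H is expanded, \<open>P\<close> is the
    remaining integral over s. Expanding the other factor as well turns it into the convolution of
    \<open>cnj h\<close> with the Gaussian kernel \<open>W\<close>.\<close>
  define P where "P x = (\<integral>s. fker s x * cnj (H s) * of_real (w s) \<partial>lborel)" for x
  have P: "P x = (\<integral>y. cnj (h y) * of_real (W (x - y)) \<partial>lborel)" for x
  proof -
    have "P x = (\<integral>s. \<integral>y. fker s x * (fker (- s) y * cnj (h y)) * of_real (w s) \<partial>lborel \<partial>lborel)"
      unfolding P_def cnj_H by (simp only: integral_mult_left_zero integral_mult_right_zero)
    also have "\<dots> = (\<integral>y. \<integral>s. fker s x * (fker (- s) y * cnj (h y)) * of_real (w s) \<partial>lborel \<partial>lborel)"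
    proof (rule lborel_Fubini_swap, rule integrable_lborel_pair_bound[OF w h])
      show "norm (case (s, y) of (s, y) \<Rightarrow> fker s x * (fker (- s) y * cnj (h y)) * of_real (w s)) \<le> norm (w s) * norm (h y)"
        for s y by (simp add: norm_mult)
    qed measurable
    also have "\<dots> = (\<integral>y. \<integral>s. cnj (h y) * (fker s (x - y) * of_real (w s)) \<partial>lborel \<partial>lborel)"
    proof (intro Bochner_Integration.integral_cong refl)
      fix y s
      have "fker s x * fker (- s) y = fker s (x - y)"
        by (simp add: mult_exp_exp algebra_simps)
      then show "fker s x * (fker (- s) y * cnj (h y)) * of_real (w s) = cnj (h y) * (fker s (x - y) * of_real (w s))"
        by (metis mult.assoc mult.commute)
    qed
    also have "\<dots> = (\<integral>y. cnj (h y) * of_real (W (x - y)) \<partial>lborel)"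
      by (simp only: integral_mult_right_zero W)
    finally show ?thesis .
  qed
  have "(\<integral>s. of_real ((norm (H s))\<^sup>2 * w s) \<partial>lborel) = (\<integral>s. H s * (cnj (H s) * of_real (w s)) \<partial>lborel)"
    by (intro Bochner_Integration.integral_cong refl) (simp only: of_real_mult complex_norm_square mult.assoc)
  also have "\<dots> = (\<integral>s. \<integral>x. fker s x * h x * (cnj (H s) * of_real (w s)) \<partial>lborel \<partial>lborel)"
    unfolding H_def by (intro Bochner_Integration.integral_cong refl integral_mult_left_zero[symmetric])
  also have "\<dots> = (\<integral>x. \<integral>s. fker s x * h x * (cnj (H s) * of_real (w s)) \<partial>lborel \<partial>lborel)"
  proof (rule lborel_Fubini_swap, rule integrable_lborel_pair_bound[OF Hw h])
    show "norm (case (s, x) of (s, x) \<Rightarrow> fker s x * h x * (cnj (H s) * of_real (w s))) \<le> norm (C * w s) * norm (h x)"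
      for s x
    proof -
      have "norm (H s) * (w s * norm (h x)) \<le> C * (w s * norm (h x))"
        by (intro mult_right_mono H_bound mult_nonneg_nonneg w_pos norm_ge_zero)
      moreover have "norm (fker s x * h x * (cnj (H s) * of_real (w s))) = norm (H s) * (w s * norm (h x))"
        using w_pos[of s] by (simp add: norm_mult)
      moreover have "norm (C * w s) * norm (h x) = C * (w s * norm (h x))"
        using w_pos[of s] C_pos by (simp add: abs_mult)
      ultimately show ?thesis by (simp only: prod.case)
    qed
  qed measurable
  also have "\<dots> = (\<integral>x. \<integral>s. h x * (fker s x * cnj (H s) * of_real (w s)) \<partial>lborel \<partial>lborel)"
    by (intro Bochner_Integration.integral_cong refl) (simp only: mult_ac)
  also have "\<dots> = (\<integral>x. h x * P x \<partial>lborel)"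
    by (simp only: integral_mult_right_zero P_def)
  finally have eq: "of_real (\<integral>s. (norm (H s))\<^sup>2 * w s \<partial>lborel) = (\<integral>x. h x * P x \<partial>lborel)"
    by (simp only: integral_complex_of_real)
  have int: "integrable lborel (\<lambda>s. (norm (H s))\<^sup>2 * w s)"
  proof (rule Bochner_Integration.integrable_bound)
    show "integrable lborel (\<lambda>s. C\<^sup>2 * w s)" using w by simp
    show "AE s in lborel. norm ((norm (H s))\<^sup>2 * w s) \<le> norm (C\<^sup>2 * w s)"
      using H_bound w_pos by (auto simp: abs_mult intro!: mult_right_mono power_mono)
  qed measurable
  \<comment> \<open>The factor 1/2 from AM-GM is put into the kernel: W/2 has mass pi in either
    variable, and the two squares contribute pi each to the final 2 pi.\<close>
  have W_int1: "(\<integral>\<^sup>+x. ennreal ((norm (h y))\<^sup>2) * ennreal (W (x - y) / 2) \<partial>lborel) = ennreal ((norm (h y))\<^sup>2) * ennreal pi" for y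
  proof -
    have "(\<integral>\<^sup>+x. ennreal (W (x - y) / 2) \<partial>lborel) = (\<integral>\<^sup>+x. ennreal pi * ennreal (normal_density y (1 / n) x) \<partial>lborel)"
      by (intro nn_integral_cong) (simp add: W_def ennreal_mult[symmetric] normal_density_def)
    also have "\<dots> = ennreal pi" using \<open>0 < n\<close> by (simp add: nn_integral_cmult nn_integral_normal_density)
    finally show ?thesis by (simp add: nn_integral_cmult)
  qed
  have W_int2: "(\<integral>\<^sup>+y. ennreal ((norm (h x))\<^sup>2) * ennreal (W (x - y) / 2) \<partial>lborel) = ennreal ((norm (h x))\<^sup>2) * ennreal pi" for x
  proof -
    have "(\<integral>\<^sup>+y. ennreal (W (x - y) / 2) \<partial>lborel) = (\<integral>\<^sup>+y. ennreal pi * ennreal (normal_density x (1 / n) y) \<partial>lborel)"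
      by (intro nn_integral_cong) (simp add: W_def ennreal_mult[symmetric] normal_density_def power2_commute)
    also have "\<dots> = ennreal pi" using \<open>0 < n\<close> by (simp add: nn_integral_cmult nn_integral_normal_density)
    finally show ?thesis by (simp add: nn_integral_cmult)
  qed
  have "(\<integral>\<^sup>+s. ennreal ((norm (H s))\<^sup>2 * w s) \<partial>lborel) = ennreal (\<integral>s. (norm (H s))\<^sup>2 * w s \<partial>lborel)"
    using int w_pos by (intro nn_integral_eq_integral) auto
  also have "(\<integral>s. (norm (H s))\<^sup>2 * w s \<partial>lborel) = norm (\<integral>x. h x * P x \<partial>lborel)"
    using w_pos unfolding eq[symmetric] norm_of_real by (simp add: abs_of_nonneg integral_nonneg_AE)
  also have "ennreal \<dots> \<le> (\<integral>\<^sup>+x. ennreal (norm (h x * P x)) \<partial>lborel)"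
  \<comment> \<open>The Bochner integral of a non-integrable function is 0, so the norm bound holds
    in that case too. The same split is made for \<open>P x\<close> below.\<close>
  proof (cases "integrable lborel (\<lambda>x. h x * P x)")
    case True then show ?thesis by (rule integral_norm_bound_ennreal)
  next
    case False then show ?thesis by (simp add: not_integrable_integral_eq)
  qed
  also have "\<dots> \<le> (\<integral>\<^sup>+x. \<integral>\<^sup>+y. (ennreal ((norm (h x))\<^sup>2) + ennreal ((norm (h y))\<^sup>2)) * ennreal (W (x - y) / 2) \<partial>lborel \<partial>lborel)"
  proof (rule nn_integral_mono)
    fix x :: real
    have W_pos: "0 \<le> W t" for t using \<open>0 < n\<close> by (simp add: W_def normal_density_nonneg)
    have "ennreal (norm (P x)) \<le> (\<integral>\<^sup>+y. ennreal (norm (cnj (h y) * of_real (W (x - y)))) \<partial>lborel)"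
    proof (cases "integrable lborel (\<lambda>y. cnj (h y) * of_real (W (x - y)))")
      case True then show ?thesis unfolding P by (rule integral_norm_bound_ennreal)
    next
      case False then show ?thesis by (simp add: P not_integrable_integral_eq)
    qed
    then have "ennreal (norm (h x * P x)) \<le> ennreal (norm (h x)) * (\<integral>\<^sup>+y. ennreal (norm (cnj (h y) * of_real (W (x - y)))) \<partial>lborel)"
      by (simp add: norm_mult ennreal_mult mult_left_mono)
    also have "\<dots> = (\<integral>\<^sup>+y. ennreal (norm (h x) * norm (h y) * W (x - y)) \<partial>lborel)"
      by (subst nn_integral_cmult[symmetric]) (auto simp: norm_mult ennreal_mult[symmetric] W_pos mult_ac intro!: nn_integral_cong)
    also have "\<dots> \<le> (\<integral>\<^sup>+y. (ennreal ((norm (h x))\<^sup>2) + ennreal ((norm (h y))\<^sup>2)) * ennreal (W (x - y) / 2) \<partial>lborel)"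
    proof (rule nn_integral_mono)
      fix y
      have "2 * (norm (h x) * norm (h y)) \<le> (norm (h x))\<^sup>2 + (norm (h y))\<^sup>2"
        using sum_squares_bound[of "norm (h x)" "norm (h y)"] by (simp add: mult_ac)
      from mult_right_mono[OF this, of "W (x - y) / 2"] W_pos[of "x - y"]
      have "norm (h x) * norm (h y) * W (x - y) \<le> ((norm (h x))\<^sup>2 + (norm (h y))\<^sup>2) * (W (x - y) / 2)"
        by simp
      then show "ennreal (norm (h x) * norm (h y) * W (x - y)) \<le> (ennreal ((norm (h x))\<^sup>2) + ennreal ((norm (h y))\<^sup>2)) * ennreal (W (x - y) / 2)"
        using W_pos[of "x - y"] by (simp add: ennreal_plus[symmetric] ennreal_mult[symmetric] ennreal_leI del: ennreal_plus)
    qed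
    finally show "ennreal (norm (h x * P x)) \<le> (\<integral>\<^sup>+y. (ennreal ((norm (h x))\<^sup>2) + ennreal ((norm (h y))\<^sup>2)) * ennreal (W (x - y) / 2) \<partial>lborel)" .
  qed
  also have "\<dots> = (\<integral>\<^sup>+x. \<integral>\<^sup>+y. ennreal ((norm (h x))\<^sup>2) * ennreal (W (x - y) / 2) \<partial>lborel \<partial>lborel)
     + (\<integral>\<^sup>+x. \<integral>\<^sup>+y. ennreal ((norm (h y))\<^sup>2) * ennreal (W (x - y) / 2) \<partial>lborel \<partial>lborel)"
    by (simp add: distrib_right nn_integral_add)
  also have "(\<integral>\<^sup>+x. \<integral>\<^sup>+y. ennreal ((norm (h y))\<^sup>2) * ennreal (W (x - y) / 2) \<partial>lborel \<partial>lborel)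
     = (\<integral>\<^sup>+y. \<integral>\<^sup>+x. ennreal ((norm (h y))\<^sup>2) * ennreal (W (x - y) / 2) \<partial>lborel \<partial>lborel)"
    by (rule pair_sigma_finite.Fubini'[symmetric]) (auto simp: pair_sigma_finite_def sigma_finite_lborel)
  also have "\<dots> = ennreal pi * (\<integral>\<^sup>+x. ennreal ((norm (h x))\<^sup>2) \<partial>lborel)"
    unfolding W_int1 by (subst nn_integral_multc) (simp_all add: mult.commute)
  also have "(\<integral>\<^sup>+x. \<integral>\<^sup>+y. ennreal ((norm (h x))\<^sup>2) * ennreal (W (x - y) / 2) \<partial>lborel \<partial>lborel)
      = ennreal pi * (\<integral>\<^sup>+x. ennreal ((norm (h x))\<^sup>2) \<partial>lborel)"
    unfolding W_int2 by (subst nn_integral_multc) (simp_all add: mult.commute)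
  also have "ennreal pi * (\<integral>\<^sup>+x. ennreal ((norm (h x))\<^sup>2) \<partial>lborel) + ennreal pi * (\<integral>\<^sup>+x. ennreal ((norm (h x))\<^sup>2) \<partial>lborel)
      = ennreal (2 * pi) * (\<integral>\<^sup>+x. ennreal ((norm (h x))\<^sup>2) \<partial>lborel)"
    unfolding distrib_right[symmetric] by (subst ennreal_plus[symmetric]) simp_all
  finally show ?thesis
    unfolding H_def w_def .
qed

text \<open>The Gaussian weights tend to 1 as their width grows, and the bound for them does not
  depend on the width, so Fatou's lemma removes the weight.\<close>

lemma Fourier_integral_L2_bound:
  fixes h :: "real \<Rightarrow> complex"
  assumes h: "integrable lborel h" and hm[measurable]: "h \<in> borel_measurable borel"
  shows "(\<integral>\<^sup>+s. ennreal ((norm (\<integral>x. fker s x * h x \<partial>lborel))\<^sup>2) \<partial>lborel)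
    \<le> ennreal (2 * pi) * (\<integral>\<^sup>+x. ennreal ((norm (h x))\<^sup>2) \<partial>lborel)"
proof -
  let ?H = "\<lambda>s. norm (\<integral>x. fker s x * h x \<partial>lborel)"
  have lim: "(\<lambda>n. ennreal ((?H s)\<^sup>2 * exp (- (s / real (Suc n))\<^sup>2 / 2))) \<longlonglongrightarrow> ennreal ((?H s)\<^sup>2)" for s
  proof (rule tendsto_ennrealI)
    have z: "(\<lambda>n. s / real (Suc n)) \<longlonglongrightarrow> 0"
      by (rule LIMSEQ_Suc[OF lim_const_over_n])
    have "(\<lambda>n. c * exp (- (s / real (Suc n))\<^sup>2 / 2)) \<longlonglongrightarrow> c * exp (- 0\<^sup>2 / 2)" for c :: real
      by (intro tendsto_intros z) simp
    then show "(\<lambda>n. (?H s)\<^sup>2 * exp (- (s / real (Suc n))\<^sup>2 / 2)) \<longlonglongrightarrow> (?H s)\<^sup>2" by simp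
  qed
  have "(\<integral>\<^sup>+s. ennreal ((?H s)\<^sup>2) \<partial>lborel)
      = (\<integral>\<^sup>+s. liminf (\<lambda>n. ennreal ((?H s)\<^sup>2 * exp (- (s / real (Suc n))\<^sup>2 / 2))) \<partial>lborel)"
    by (intro nn_integral_cong lim_imp_Liminf[symmetric] lim) simp
  also have "\<dots> \<le> liminf (\<lambda>n. \<integral>\<^sup>+s. ennreal ((?H s)\<^sup>2 * exp (- (s / real (Suc n))\<^sup>2 / 2)) \<partial>lborel)"
    by (rule nn_integral_liminf) measurable
  also have "\<dots> \<le> liminf (\<lambda>n. ennreal (2 * pi) * (\<integral>\<^sup>+x. ennreal ((norm (h x))\<^sup>2) \<partial>lborel))"
    by (intro Liminf_mono always_eventually allI Fourier_integral_gaussian_L2_bound[OF h hm]) simp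
  finally show ?thesis by (simp add: Liminf_const)
qed

lemma Fourier1_L2_bound:
  assumes "Lp 1 h"
  shows "(\<integral>\<^sup>+s. ennreal ((norm (Fourier1 h s))\<^sup>2) \<partial>lebesgue) \<le> (\<integral>\<^sup>+x. ennreal ((norm (h x))\<^sup>2) \<partial>lebesgue)"
proof -
  have h: "integrable lebesgue h" using assms by (simp add: Lp_1_iff_integrable)
  obtain h' where h'[measurable]: "h' \<in> borel_measurable borel" and eq: "AE x in lebesgue. h x = h' x"
    using lebesgue_measurable_AE_eq_borel_complex[OF borel_measurable_integrable[OF h]] by blast
  have h'leb: "h' \<in> borel_measurable lebesgue" using measurable_completion[of h' lborel borel] by simp
  have "integrable lebesgue h'"
    using integrable_cong_AE[OF borel_measurable_integrable[OF h] h'leb eq] h by simp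
  then have int: "integrable lborel h'" by (subst (asm) integrable_completion) auto
  have "(\<integral>x. fker s x * h x \<partial>lebesgue) = (\<integral>x. fker s x * h' x \<partial>lborel)" for s
  proof -
    have "(\<integral>x. fker s x * h x \<partial>lebesgue) = (\<integral>x. fker s x * h' x \<partial>lebesgue)"
      using eq borel_measurable_integrable[OF h] h'leb
      by (intro integral_cong_AE borel_measurable_times borel_measurable_fker_lebesgue) auto
    also have "\<dots> = (\<integral>x. fker s x * h' x \<partial>lborel)"
      by (rule integral_completion) simp
    finally show ?thesis .
  qed
  then have F: "ennreal ((norm (Fourier1 h s))\<^sup>2) = ennreal (1 / (2 * pi)) * ennreal ((norm (\<integral>x. fker s x * h' x \<partial>lborel))\<^sup>2)" for s
    by (simp add: Fourier1_def norm_mult power_mult_distrib norm_divide power_divide ennreal_mult[symmetric])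
  have "(\<integral>\<^sup>+s. ennreal ((norm (Fourier1 h s))\<^sup>2) \<partial>lebesgue)
     = ennreal (1 / (2 * pi)) * (\<integral>\<^sup>+s. ennreal ((norm (\<integral>x. fker s x * h' x \<partial>lborel))\<^sup>2) \<partial>lborel)"
    unfolding F nn_integral_completion by (rule nn_integral_cmult) measurable
  also have "\<dots> \<le> ennreal (1 / (2 * pi)) * (ennreal (2 * pi) * (\<integral>\<^sup>+x. ennreal ((norm (h' x))\<^sup>2) \<partial>lborel))"
    by (intro mult_left_mono Fourier_integral_L2_bound int h') simp
  also have "\<dots> = (\<integral>\<^sup>+x. ennreal ((norm (h' x))\<^sup>2) \<partial>lborel)"
    by (simp add: mult.assoc[symmetric] ennreal_mult[symmetric])
  also have "\<dots> = (\<integral>\<^sup>+x. ennreal ((norm (h x))\<^sup>2) \<partial>lebesgue)"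
    unfolding nn_integral_completion[of lborel "\<lambda>x. ennreal ((norm (h' x))\<^sup>2)", symmetric]
    using eq by (intro nn_integral_cong_AE) auto
  finally show ?thesis .
qed

section \<open>Identification of the Plancherel transform\<close>

text \<open>The squared L^2 norm as an extended nonnegative integral: infinite values are kept, and
  Fatou's lemma and the triangle estimate apply without integrability conditions. The specification
  of \<open>Fourier2\<close> uses Bochner integrals, hence the translations
  \<open>L2sq_tendsto_0I\<close> and \<open>L2sq_tendsto_0D\<close>.\<close>

definition L2sq :: "(real \<Rightarrow> complex) \<Rightarrow> ennreal" where
  "L2sq f = (\<integral>\<^sup>+x. ennreal ((norm (f x))\<^sup>2) \<partial>lebesgue)"

lemma Lp_2_iff: "Lp 2 f \<longleftrightarrow> f \<in> borel_measurable lebesgue \<and> L2sq f < \<infinity>"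
proof -
  have "norm (f x) powr 2 = (norm (f x))\<^sup>2" for x by simp
  then show ?thesis
    unfolding Lp_def L2sq_def by (auto simp: integrable_iff_bounded)
qed

lemma Lp_diff_1: "Lp 1 f \<Longrightarrow> Lp 1 g \<Longrightarrow> Lp 1 (\<lambda>x. f x - g x)"
  by (simp add: Lp_1_iff_integrable)

lemma integral_norm_square_eq:
  assumes "f \<in> borel_measurable lebesgue"
  shows "(\<integral>x. (norm (f x :: complex))\<^sup>2 \<partial>lebesgue) = enn2real (L2sq f)"
  unfolding L2sq_def using assms by (intro integral_eq_nn_integral) auto

text \<open>Squared norms obey the triangle inequality only up to a factor 2, from (a + b)^2 <= 2
  a^2 + 2 b^2. This suffices for limits that are zero.\<close>

lemma L2sq_triangle:
  assumes [measurable]: "f \<in> borel_measurable lebesgue" "g \<in> borel_measurable lebesgue" "h \<in> borel_measurable lebesgue"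
  shows "L2sq (\<lambda>x. f x - h x) \<le> 2 * L2sq (\<lambda>x. f x - g x) + 2 * L2sq (\<lambda>x. g x - h x)"
proof -
  have "L2sq (\<lambda>x. f x - h x) \<le> (\<integral>\<^sup>+x. 2 * ennreal ((norm (f x - g x))\<^sup>2) + 2 * ennreal ((norm (g x - h x))\<^sup>2) \<partial>lebesgue)"
    unfolding L2sq_def
  proof (rule nn_integral_mono)
    fix x
    let ?a = "norm (f x - g x)" and ?b = "norm (g x - h x)"
    have "norm (f x - h x) \<le> ?a + ?b"
      using norm_triangle_ineq[of "f x - g x" "g x - h x"] by simp
    then have "(norm (f x - h x))\<^sup>2 \<le> (?a + ?b)\<^sup>2" by (intro power_mono) auto
    also have "\<dots> \<le> 2 * ?a\<^sup>2 + 2 * ?b\<^sup>2"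
      using sum_squares_bound[of ?a ?b] by (simp add: power2_sum)
    finally have "ennreal ((norm (f x - h x))\<^sup>2) \<le> ennreal (2 * ?a\<^sup>2 + 2 * ?b\<^sup>2)" by (rule ennreal_leI)
    then show "ennreal ((norm (f x - h x))\<^sup>2) \<le> 2 * ennreal (?a\<^sup>2) + 2 * ennreal (?b\<^sup>2)"
      by (simp add: ennreal_mult)
  qed
  also have "\<dots> = 2 * L2sq (\<lambda>x. f x - g x) + 2 * L2sq (\<lambda>x. g x - h x)"
    unfolding L2sq_def by (subst nn_integral_add) (auto simp: nn_integral_cmult)
  finally show ?thesis .
qed

lemma L2sq_commute: "L2sq (\<lambda>x. f x - g x) = L2sq (\<lambda>x. g x - f x)"
  unfolding L2sq_def by (simp add: norm_minus_commute)

lemma integrable_fker_Lp_1: "Lp 1 f \<Longrightarrow> integrable lebesgue (\<lambda>x. fker s x * f x)"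
  unfolding Lp_1_iff_integrable by (rule integrable_fker_mult[OF _ borel_measurable_fker_lebesgue])

lemma Fourier1_diff:
  assumes "Lp 1 f" "Lp 1 g"
  shows "Fourier1 (\<lambda>x. f x - g x) s = Fourier1 f s - Fourier1 g s"
proof -
  have "integrable lebesgue (\<lambda>x. fker s x * f x)" "integrable lebesgue (\<lambda>x. fker s x * g x)"
    by (rule integrable_fker_Lp_1[OF assms(1)], rule integrable_fker_Lp_1[OF assms(2)])
  from Bochner_Integration.integral_diff[OF this] show ?thesis
    by (simp add: Fourier1_def right_diff_distrib)
qed

lemma continuous_on_Fourier1: "Lp 1 f \<Longrightarrow> continuous_on UNIV (Fourier1 f)"
  unfolding Fourier1_def Lp_1_iff_integrable
  by (intro continuous_on_mult continuous_on_const continuous_on_Fourier_integral)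

lemma borel_measurable_Fourier1: "Lp 1 f \<Longrightarrow> Fourier1 f \<in> borel_measurable lebesgue"
  using borel_measurable_continuous_onI[OF continuous_on_Fourier1]
    measurable_completion[of "Fourier1 f" lborel borel] by simp

lemma L2sq_Fourier1_diff_le:
  assumes "Lp 1 f" "Lp 1 g"
  shows "L2sq (\<lambda>s. Fourier1 f s - Fourier1 g s) \<le> L2sq (\<lambda>x. f x - g x)"
  using Fourier1_L2_bound[OF Lp_diff_1[OF assms]] by (simp add: L2sq_def Fourier1_diff[OF assms])

section \<open>Truncations and convergence in L^2\<close>

definition trunc :: "nat \<Rightarrow> (real \<Rightarrow> complex) \<Rightarrow> real \<Rightarrow> complex" where
  "trunc n f x = (if x \<in> {- real n..real n} then f x else 0)"

lemma borel_measurable_trunc: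
  assumes "f \<in> borel_measurable lebesgue"
  shows "trunc n f \<in> borel_measurable lebesgue"
proof -
  have "(\<lambda>x. indicator {- real n..real n} x *\<^sub>R f x) \<in> borel_measurable lebesgue"
    using assms by (intro borel_measurable_scaleR borel_measurable_indicator) auto
  also have "(\<lambda>x. indicator {- real n..real n} x *\<^sub>R f x) = trunc n f"
    by (auto simp: trunc_def)
  finally show ?thesis .
qed

text \<open>On a bounded interval 1 + |f|^2 is an integrable majorant of |f|.\<close>

lemma Lp_1_trunc_of_Lp_2:
  assumes "Lp 2 f"
  shows "Lp 1 (trunc n f)"
  unfolding Lp_1_iff_integrable
proof (rule Bochner_Integration.integrable_bound)
  have f: "f \<in> borel_measurable lebesgue" "integrable lebesgue (\<lambda>x. (norm (f x))\<^sup>2)"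
    using assms by (auto simp: Lp_def)
  show "integrable lebesgue (\<lambda>x. indicator {- real n..real n} x + (norm (f x))\<^sup>2)"
    using f(2) by (intro Bochner_Integration.integrable_add integrable_real_indicator) auto
  show "trunc n f \<in> borel_measurable lebesgue" by (rule borel_measurable_trunc[OF f(1)])
  show "AE x in lebesgue. norm (trunc n f x) \<le> norm (indicator {- real n..real n} x + (norm (f x))\<^sup>2)"
  proof (rule AE_I2)
    fix x
    have "norm (f x) \<le> 1 + (norm (f x))\<^sup>2"
      using sum_squares_bound[of "norm (f x)" 1] zero_le_power2[of "norm (f x)"]
      unfolding power_one mult_1_right by linarith
    then show "norm (trunc n f x) \<le> norm (indicator {- real n..real n} x + (norm (f x))\<^sup>2)"
      by (auto simp: trunc_def)
  qed
qed

lemma L2sq_mono: "(\<And>x. norm (f x) \<le> norm (g x)) \<Longrightarrow> L2sq f \<le> L2sq g"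
  unfolding L2sq_def by (intro nn_integral_mono ennreal_leI power_mono) auto

lemma Lp_2_trunc:
  assumes "Lp 2 f"
  shows "Lp 2 (trunc n f)"
proof -
  have "L2sq (trunc n f) \<le> L2sq f"
    by (rule L2sq_mono) (simp add: trunc_def)
  also have "\<dots> < \<infinity>" using assms by (simp add: Lp_2_iff)
  finally show ?thesis
    using assms borel_measurable_trunc by (simp add: Lp_2_iff)
qed

lemma L2sq_trunc_tendsto:
  assumes "Lp 2 f"
  shows "(\<lambda>n. L2sq (\<lambda>x. trunc n f x - f x)) \<longlonglongrightarrow> 0"
proof -
  have f[measurable]: "f \<in> borel_measurable lebesgue" and fin: "L2sq f < \<infinity>"
    using assms by (auto simp: Lp_2_iff)
  have t[measurable]: "trunc n f \<in> borel_measurable lebesgue" for n by (rule borel_measurable_trunc[OF f])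
  have "(\<lambda>n. \<integral>\<^sup>+x. ennreal ((norm (trunc n f x - f x))\<^sup>2) \<partial>lebesgue) \<longlonglongrightarrow> (\<integral>\<^sup>+x. 0 \<partial>(lebesgue :: real measure))"
  proof (rule nn_integral_dominated_convergence[where w = "\<lambda>x. ennreal ((norm (f x))\<^sup>2)" and u' = "\<lambda>_. 0"])
    show "AE x in lebesgue. ennreal ((norm (trunc n f x - f x))\<^sup>2) \<le> ennreal ((norm (f x))\<^sup>2)" for n
      by (auto simp: trunc_def)
    show "(\<integral>\<^sup>+x. ennreal ((norm (f x))\<^sup>2) \<partial>lebesgue) < \<infinity>" using fin by (simp add: L2sq_def)
    show "AE x in lebesgue. (\<lambda>n. ennreal ((norm (trunc n f x - f x))\<^sup>2)) \<longlonglongrightarrow> 0"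
    proof (rule AE_I2)
      fix x :: real
      obtain N :: nat where "\<bar>x\<bar> \<le> real N" using real_arch_simple by blast
      then have "\<forall>n\<ge>N. ennreal ((norm (trunc n f x - f x))\<^sup>2) = 0" by (auto simp: trunc_def)
      then show "(\<lambda>n. ennreal ((norm (trunc n f x - f x))\<^sup>2)) \<longlonglongrightarrow> 0"
        by (intro tendsto_eventually) (auto simp: eventually_sequentially)
    qed
  qed auto
  then show ?thesis by (simp add: L2sq_def)
qed

lemma L2sq_tendsto_0I:
  assumes "\<And>n. f n \<in> borel_measurable lebesgue" "(\<lambda>n. L2sq (f n)) \<longlonglongrightarrow> 0"
  shows "(\<lambda>n. \<integral>x. (norm (f n x))\<^sup>2 \<partial>lebesgue) \<longlonglongrightarrow> 0"
  using tendsto_enn2real[of "\<lambda>n. L2sq (f n)" 0 sequentially] assms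
  by (simp add: integral_norm_square_eq)

text \<open>Finiteness matters: \<open>enn2real\<close> sends infinity to 0, so functions of
  infinite norm would look like a null sequence.\<close>

lemma L2sq_tendsto_0D:
  assumes "\<And>n. f n \<in> borel_measurable lebesgue" "\<And>n. L2sq (f n) < \<infinity>"
    and "(\<lambda>n. \<integral>x. (norm (f n x))\<^sup>2 \<partial>lebesgue) \<longlonglongrightarrow> 0"
  shows "(\<lambda>n. L2sq (f n)) \<longlonglongrightarrow> 0"
proof -
  have "(\<lambda>n. ennreal (enn2real (L2sq (f n)))) \<longlonglongrightarrow> ennreal 0"
    using assms(1,3) by (intro tendsto_ennrealI) (simp add: integral_norm_square_eq)
  then show ?thesis using assms(2) by simp
qed

lemma L2sq_diff_finite:
  assumes "Lp 2 f" "Lp 2 g"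
  shows "L2sq (\<lambda>x. f x - g x) < \<infinity>"
proof -
  have "L2sq (\<lambda>x. f x - g x) \<le> 2 * L2sq (\<lambda>x. f x - 0) + 2 * L2sq (\<lambda>x. 0 - g x)"
    using assms by (intro L2sq_triangle) (auto simp: Lp_2_iff)
  also have "\<dots> = 2 * L2sq f + 2 * L2sq g" by (simp add: L2sq_def)
  also have "\<dots> < \<infinity>" using assms by (auto simp: Lp_2_iff ennreal_mult_less_top)
  finally show ?thesis .
qed

lemma ennreal_cmult_tendsto_0:
  assumes "e \<longlonglongrightarrow> (0::ennreal)" "c < \<infinity>"
  shows "(\<lambda>n. c * e n) \<longlonglongrightarrow> 0"
  using ennreal_tendsto_cmult[OF _ assms(1), of c] assms(2) by simp

text \<open>If the transforms of the truncations of \<open>f\<close> converge pointwise a.e., the limit has the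
  defining property of the Plancherel transform: Fatou's lemma upgrades the pointwise limit to an
  \<open>L\<^sup>2\<close> limit, so completeness of \<open>L\<^sup>2\<close> is not needed.\<close>

lemma Fourier2_AE_eq:
  assumes f: "Lp 2 f" and lim: "AE s in lebesgue. (\<lambda>n. Fourier1 (trunc n f) s) \<longlonglongrightarrow> g s"
  shows "AE s in lebesgue. Fourier2 f s = g s"
proof -
  let ?t = "\<lambda>n. trunc n f"
  let ?F = "\<lambda>n. Fourier1 (trunc n f)"
  define e where "e n = L2sq (\<lambda>x. ?t n x - f x)" for n
  have e0: "e \<longlonglongrightarrow> 0" unfolding e_def by (rule L2sq_trunc_tendsto[OF f])
  have fm: "f \<in> borel_measurable lebesgue" using f by (simp add: Lp_2_iff)
  have t1: "Lp 1 (?t n)" for n by (rule Lp_1_trunc_of_Lp_2[OF f])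
  have t2: "Lp 2 (?t n)" for n by (rule Lp_2_trunc[OF f])
  have tm: "?t n \<in> borel_measurable lebesgue" for n by (rule borel_measurable_trunc[OF fm])
  have Fm: "?F n \<in> borel_measurable lebesgue" for n by (rule borel_measurable_Fourier1[OF t1])
  \<comment> \<open>Off the set of convergence \<open>g\<close> is arbitrary; its measurability
    comes from that of \<open>lim\<close> together with completeness of
    \<open>lebesgue\<close>.\<close>
  have gm: "g \<in> borel_measurable lebesgue"
  proof (rule borel_measurable_AE)
    show "(\<lambda>s. lim (\<lambda>n. ?F n s)) \<in> borel_measurable lebesgue"
      using Fm by (rule borel_measurable_lim_metric)
    show "AE s in lebesgue. lim (\<lambda>n. ?F n s) = g s"
      using lim by eventually_elim (rule limI)
  qed
  have F_g: "L2sq (\<lambda>s. ?F n s - g s) \<le> e n" for n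
  proof -
    have "L2sq (\<lambda>s. ?F n s - g s) = (\<integral>\<^sup>+s. liminf (\<lambda>m. ennreal ((norm (?F n s - ?F m s))\<^sup>2)) \<partial>lebesgue)"
      unfolding L2sq_def
    proof (rule nn_integral_cong_AE, use lim in eventually_elim)
      fix s assume "(\<lambda>n. ?F n s) \<longlonglongrightarrow> g s"
      then have "(\<lambda>m. ennreal ((norm (?F n s - ?F m s))\<^sup>2)) \<longlonglongrightarrow> ennreal ((norm (?F n s - g s))\<^sup>2)"
        by (intro tendsto_ennrealI tendsto_power tendsto_norm tendsto_diff tendsto_const)
      then show "ennreal ((norm (?F n s - g s))\<^sup>2) = liminf (\<lambda>m. ennreal ((norm (?F n s - ?F m s))\<^sup>2))"
        by (intro lim_imp_Liminf[symmetric]) simp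
    qed
    also have "\<dots> \<le> liminf (\<lambda>m. L2sq (\<lambda>s. ?F n s - ?F m s))"
      unfolding L2sq_def using Fm by (intro nn_integral_liminf) auto
    \<comment> \<open>For m >= n the difference of the truncations is |f| on n < |x| <= m and 0
      elsewhere, hence at most |?t n - f| pointwise. The bound \<open>e n\<close> is therefore free
      of m.\<close>
    also have "\<dots> \<le> liminf (\<lambda>m. e n)"
    proof (rule Liminf_mono, rule eventually_sequentiallyI)
      fix m assume "n \<le> m"
      have "L2sq (\<lambda>s. ?F n s - ?F m s) \<le> L2sq (\<lambda>x. ?t n x - ?t m x)"
        by (rule L2sq_Fourier1_diff_le[OF t1 t1])
      also have "\<dots> \<le> e n"
        unfolding e_def by (rule L2sq_mono) (use \<open>n \<le> m\<close> in \<open>auto simp: trunc_def\<close>)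
      finally show "L2sq (\<lambda>s. ?F n s - ?F m s) \<le> e n" .
    qed
    finally show ?thesis by (simp add: Liminf_const)
  qed
  let ?spec = "\<lambda>g. Lp 2 g \<and>
     (\<forall>F :: nat \<Rightarrow> real \<Rightarrow> complex.
        (\<forall>n. Lp 1 (F n) \<and> Lp 2 (F n)) \<and>
        (\<lambda>n. \<integral>x. norm (F n x - f x) ^ 2 \<partial>lebesgue) \<longlonglongrightarrow> 0
        \<longrightarrow> (\<lambda>n. \<integral>s. norm (Fourier1 (F n) s - g s) ^ 2 \<partial>lebesgue) \<longlonglongrightarrow> 0)"
  \<comment> \<open>The index 0 is arbitrary: one square integrable transform at finite L^2 distance
    from \<open>g\<close> puts \<open>g\<close> into L^2.\<close>
  have "Lp 2 (?F 0)"
    unfolding Lp_2_iff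
  proof
    show "?F 0 \<in> borel_measurable lebesgue" by (rule Fm)
    have "L2sq (?F 0) \<le> L2sq (?t 0)"
      using Fourier1_L2_bound[OF t1] by (simp add: L2sq_def)
    then show "L2sq (?F 0) < \<infinity>" using t2[of 0] by (auto simp: Lp_2_iff intro: le_less_trans)
  qed
  have "L2sq (\<lambda>s. g s - 0) \<le> 2 * L2sq (\<lambda>s. g s - ?F 0 s) + 2 * L2sq (\<lambda>s. ?F 0 s - 0)"
    using gm Fm by (intro L2sq_triangle) auto
  also have "\<dots> < \<infinity>"
  proof -
    have "L2sq (\<lambda>s. g s - ?F 0 s) < \<infinity>"
      using F_g[of 0] L2sq_diff_finite[OF t2 f, of 0] by (subst L2sq_commute) (simp add: e_def le_less_trans)
    then show ?thesis using \<open>Lp 2 (?F 0)\<close> by (simp add: Lp_2_iff ennreal_mult_less_top)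
  qed
  finally have g2: "Lp 2 g" using gm by (simp add: Lp_2_iff)
  have "?spec g"
  proof (intro conjI allI impI g2)
    fix F :: "nat \<Rightarrow> real \<Rightarrow> complex"
    assume *: "(\<forall>n. Lp 1 (F n) \<and> Lp 2 (F n)) \<and> (\<lambda>n. \<integral>x. (norm (F n x - f x))\<^sup>2 \<partial>lebesgue) \<longlonglongrightarrow> 0"
    have F1: "Lp 1 (F n)" and F2: "Lp 2 (F n)" for n using * by auto
    have F1m: "Fourier1 (F n) \<in> borel_measurable lebesgue" for n by (rule borel_measurable_Fourier1[OF F1])
    have Fnm: "F n \<in> borel_measurable lebesgue" for n using F2 by (simp add: Lp_2_iff)
    have lim0: "(\<lambda>n. L2sq (\<lambda>x. F n x - f x)) \<longlonglongrightarrow> 0"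
      using * Fnm fm L2sq_diff_finite[OF F2 f] by (intro L2sq_tendsto_0D) auto
    have bound: "L2sq (\<lambda>s. Fourier1 (F k) s - g s) \<le> 4 * L2sq (\<lambda>x. F k x - f x)" for k
    proof -
      \<comment> \<open>Two triangle estimates through the truncation ?t n, one before and one after
        the transform, produce the constants 2 * 2 = 4 and 2 * 2 + 2 = 6. Then n tends to infinity
        with k fixed.\<close>
      have le: "L2sq (\<lambda>s. Fourier1 (F k) s - g s) \<le> 4 * L2sq (\<lambda>x. F k x - f x) + 6 * e n" for n
      proof -
        have "L2sq (\<lambda>x. F k x - ?t n x) \<le> 2 * L2sq (\<lambda>x. F k x - f x) + 2 * L2sq (\<lambda>x. f x - ?t n x)"
          by (intro L2sq_triangle Fnm fm tm)
        then have 1: "L2sq (\<lambda>x. F k x - ?t n x) \<le> 2 * L2sq (\<lambda>x. F k x - f x) + 2 * e n"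
          unfolding e_def by (subst (asm) (3) L2sq_commute)
        have "L2sq (\<lambda>s. Fourier1 (F k) s - g s)
            \<le> 2 * L2sq (\<lambda>s. Fourier1 (F k) s - ?F n s) + 2 * L2sq (\<lambda>s. ?F n s - g s)"
          by (intro L2sq_triangle F1m Fm gm)
        also have "\<dots> \<le> 2 * (2 * L2sq (\<lambda>x. F k x - f x) + 2 * e n) + 2 * e n"
          by (intro add_mono mult_left_mono F_g order_trans[OF L2sq_Fourier1_diff_le[OF F1 t1] 1]) auto
        also have "\<dots> = 4 * L2sq (\<lambda>x. F k x - f x) + 6 * e n"
          by (simp add: distrib_left mult.assoc[symmetric] add.assoc flip: distrib_right)
        finally show ?thesis .
      qed
      have "(\<lambda>n. 4 * L2sq (\<lambda>x. F k x - f x) + 6 * e n) \<longlonglongrightarrow> 4 * L2sq (\<lambda>x. F k x - f x) + 0"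
        by (intro tendsto_add tendsto_const ennreal_cmult_tendsto_0 e0) simp
      from LIMSEQ_le_const[OF this] le show ?thesis by auto
    qed
    have "(\<lambda>n. L2sq (\<lambda>s. Fourier1 (F n) s - g s)) \<longlonglongrightarrow> 0"
    proof (rule tendsto_sandwich[where f = "\<lambda>_. 0"])
      show "(\<lambda>n. 4 * L2sq (\<lambda>x. F n x - f x)) \<longlonglongrightarrow> 0"
        by (intro ennreal_cmult_tendsto_0 lim0) simp
    qed (use bound in auto)
    then show "(\<lambda>n. \<integral>s. (norm (Fourier1 (F n) s - g s))\<^sup>2 \<partial>lebesgue) \<longlonglongrightarrow> 0"
      using F1m gm by (intro L2sq_tendsto_0I) auto
  qed
  then have F2_spec: "?spec (Fourier2 f)"
    unfolding Fourier2_def by (rule someI[where P = ?spec])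
  then have h2: "Lp 2 (Fourier2 f)" by blast
  then have hm: "Fourier2 f \<in> borel_measurable lebesgue" by (simp add: Lp_2_iff)
  \<comment> \<open>The chosen \<open>Fourier2 f\<close> is tested on the truncations: it is an L^2
    limit of the same transforms as \<open>g\<close>, so the two differ by a function of norm
    0.\<close>
  have "(\<lambda>n. \<integral>s. (norm (?t n s - f s))\<^sup>2 \<partial>lebesgue) \<longlonglongrightarrow> 0"
    using tm fm L2sq_trunc_tendsto[OF f] by (intro L2sq_tendsto_0I) auto
  with F2_spec[THEN conjunct2, THEN spec, of ?t] t1 t2
  have "(\<lambda>n. \<integral>s. (norm (?F n s - Fourier2 f s))\<^sup>2 \<partial>lebesgue) \<longlonglongrightarrow> 0"
    by blast
  moreover have "L2sq (\<lambda>s. ?F n s - Fourier2 f s) < \<infinity>" for n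
  proof (rule L2sq_diff_finite[OF _ h2])
    have "L2sq (?F n) \<le> L2sq (?t n)"
      using Fourier1_L2_bound[OF t1] by (simp add: L2sq_def)
    then show "Lp 2 (?F n)" using t2[of n] Fm by (auto simp: Lp_2_iff intro: le_less_trans)
  qed
  ultimately have lim2: "(\<lambda>n. L2sq (\<lambda>s. ?F n s - Fourier2 f s)) \<longlonglongrightarrow> 0"
    using Fm hm by (intro L2sq_tendsto_0D) auto
  have "L2sq (\<lambda>s. Fourier2 f s - g s) \<le> 2 * L2sq (\<lambda>s. ?F n s - Fourier2 f s) + 2 * e n" for n
  proof -
    have "L2sq (\<lambda>s. Fourier2 f s - g s) \<le> 2 * L2sq (\<lambda>s. Fourier2 f s - ?F n s) + 2 * L2sq (\<lambda>s. ?F n s - g s)"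
      by (intro L2sq_triangle hm Fm gm)
    also have "\<dots> \<le> 2 * L2sq (\<lambda>s. ?F n s - Fourier2 f s) + 2 * e n"
      using F_g by (subst L2sq_commute) (intro add_mono mult_left_mono order_refl, auto)
    finally show ?thesis .
  qed
  moreover have "(\<lambda>n. 2 * L2sq (\<lambda>s. ?F n s - Fourier2 f s) + 2 * e n) \<longlonglongrightarrow> 0 + 0"
    by (intro tendsto_add ennreal_cmult_tendsto_0 e0 lim2) simp_all
  ultimately have "L2sq (\<lambda>s. Fourier2 f s - g s) \<le> 0 + 0"
    by (intro LIMSEQ_le_const) auto
  then have "L2sq (\<lambda>s. Fourier2 f s - g s) = 0" by simp
  then have "AE s in lebesgue. ennreal ((norm (Fourier2 f s - g s))\<^sup>2) = 0"
    unfolding L2sq_def using hm gm by (subst (asm) nn_integral_0_iff_AE) auto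
  then show ?thesis by eventually_elim simp
qed

section \<open>The transforms of a function in Lp, BV and AC\<close>

text \<open>Two exponents occur so that a bound relating different powers of the norms yields
  membership in a different L^q.\<close>

lemma Lp_dominated:
  assumes "Lp p f" "h \<in> borel_measurable lebesgue"
    and "\<And>x. norm (h x) powr q \<le> norm (f x) powr p"
  shows "Lp q h"
  unfolding Lp_def
proof
  show "integrable lebesgue (\<lambda>x. norm (h x) powr q)"
  proof (rule Bochner_Integration.integrable_bound)
    show "integrable lebesgue (\<lambda>x. norm (f x) powr p)" using assms(1) by (simp add: Lp_def)
    show "(\<lambda>x. norm (h x) powr q) \<in> borel_measurable lebesgue" using assms(2) by simp
  qed (use assms(3) in simp)
qed fact

text \<open>Cut at |f| = 1: raising the exponent from 1 to p enlarges values of at least 1, and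
  raising it from p to 2 shrinks values below 1, so |f|^p dominates both parts.\<close>

lemma Lp_split:
  assumes f: "Lp p f" and p: "1 \<le> p" "p \<le> 2"
  obtains f1 f2 where "\<forall>x. f x = f1 x + f2 x" "Lp 1 f1" "Lp p f1" "Lp 2 f2" "Lp p f2"
proof
  let ?f1 = "\<lambda>x. if 1 \<le> norm (f x) then f x else 0"
  let ?f2 = "\<lambda>x. if 1 \<le> norm (f x) then 0 else f x"
  have [measurable]: "f \<in> borel_measurable lebesgue" using f by (simp add: Lp_def)
  have m: "?f1 \<in> borel_measurable lebesgue" "?f2 \<in> borel_measurable lebesgue" by measurable
  show "\<forall>x. f x = ?f1 x + ?f2 x" by simp
  show "Lp 1 ?f1"
    using p powr_mono[of 1 p] by (intro Lp_dominated[OF f m(1)]) auto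
  show "Lp p ?f1" by (intro Lp_dominated[OF f m(1)]) auto
  show "Lp 2 ?f2"
    \<comment> \<open>\<open>powr_numeral\<close> would turn \<open>powr 2\<close> into a power, to
      which the monotonicity rule for \<open>powr\<close> does not apply.\<close>
    using p powr_mono'[of p 2] by (intro Lp_dominated[OF f m(2)]) (auto simp del: powr_numeral)
  show "Lp p ?f2" by (intro Lp_dominated[OF f m(2)]) auto
qed

section \<open>Partial integrals over [-n, n]\<close>

lemma has_integral_UNIV_imp_integral_Icc_tendsto:
  fixes f :: "real \<Rightarrow> 'b::banach"
  assumes "(f has_integral I) UNIV"
  shows "(\<lambda>n. integral {- real n..real n} f) \<longlonglongrightarrow> I"
proof (rule LIMSEQ_I)
  fix e :: real assume "0 < e"
  then obtain B where "B > 0" and B: "\<And>a b. ball 0 B \<subseteq> cbox a b \<Longrightarrow> norm (integral (cbox a b) f - I) < e"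
    using assms unfolding has_integral_alt'[of f I UNIV] by auto
  obtain N :: nat where "B \<le> real N" using real_arch_simple by blast
  have "norm (integral {- real n..real n} f - I) < e" if "N \<le> n" for n
  proof -
    have "ball 0 B \<subseteq> cbox (- real n) (real n)"
      using \<open>B \<le> real N\<close> that by (auto simp: cbox_interval dist_real_def)
    from B[OF this] show ?thesis by (simp add: cbox_interval)
  qed
  then show "\<exists>N. \<forall>n\<ge>N. norm (integral {- real n..real n} f - I) < e" by blast
qed

lemma Lp_1_trunc:
  assumes "Lp 1 f"
  shows "Lp 1 (trunc n f)"
  using assms by (intro Lp_dominated[OF assms] borel_measurable_trunc) (auto simp: Lp_def trunc_def)

lemma Lp_1_trunc_of_continuous:
  assumes "continuous_on UNIV f"
  shows "Lp 1 (trunc n f)"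
proof -
  have "f absolutely_integrable_on {- real n..real n}"
    by (rule absolutely_integrable_continuous_real, rule continuous_on_subset[OF assms]) simp
  moreover have "(\<lambda>x. indicator {- real n..real n} x *\<^sub>R f x) = trunc n f"
    by (auto simp: trunc_def)
  ultimately show ?thesis by (simp add: set_integrable_def Lp_1_iff_integrable)
qed

lemma Fourier1_trunc:
  assumes "Lp 1 (trunc n f)"
  shows "Fourier1 (trunc n f) s = of_real (1 / sqrt (2 * pi)) * integral {- real n..real n} (\<lambda>x. fker s x * f x)"
proof -
  have "((\<lambda>x. fker s x * trunc n f x) has_integral (\<integral>x. fker s x * trunc n f x \<partial>lebesgue)) UNIV"
    by (rule has_integral_integral_lebesgue[OF integrable_fker_Lp_1[OF assms]])
  moreover have "(\<lambda>x. fker s x * trunc n f x) = (\<lambda>x. if x \<in> {- real n..real n} then fker s x * f x else 0)"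
    by (auto simp: trunc_def)
  ultimately have "((\<lambda>x. fker s x * f x) has_integral (\<integral>x. fker s x * trunc n f x \<partial>lebesgue)) {- real n..real n}"
    by (simp only: has_integral_restrict_UNIV)
  then show ?thesis unfolding Fourier1_def by (simp add: integral_unique)
qed

lemma Fourier1_eq_FourierHK:
  assumes "Lp 1 f"
  shows "Fourier1 f s = FourierHK f s"
  using has_integral_integral_lebesgue[OF integrable_fker_Lp_1[OF assms], of s]
  unfolding Fourier1_def FourierHK_def by (simp add: integral_unique)

lemma Fourier1_trunc_tendsto_FourierHK:
  assumes "continuous_on UNIV f" "(\<lambda>x. fker s x * f x) integrable_on UNIV"
  shows "(\<lambda>n. Fourier1 (trunc n f) s) \<longlonglongrightarrow> FourierHK f s"
  unfolding Fourier1_trunc[OF Lp_1_trunc_of_continuous[OF assms(1)]] FourierHK_def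
  by (intro tendsto_mult tendsto_const has_integral_UNIV_imp_integral_Icc_tendsto integrable_integral assms)

lemma Fourier1_trunc_tendsto_Fourier1:
  assumes "Lp 1 f"
  shows "(\<lambda>n. Fourier1 (trunc n f) s) \<longlonglongrightarrow> Fourier1 f s"
proof -
  have "((\<lambda>x. fker s x * f x) has_integral (\<integral>x. fker s x * f x \<partial>lebesgue)) UNIV"
    by (rule has_integral_integral_lebesgue[OF integrable_fker_Lp_1[OF assms]])
  then show ?thesis
    unfolding Fourier1_trunc[OF Lp_1_trunc[OF assms]] unfolding Fourier1_def
    by (intro tendsto_mult tendsto_const has_integral_UNIV_imp_integral_Icc_tendsto)
qed

lemma AE_lebesgue_nonzero: "AE s in lebesgue. (s::real) \<noteq> 0"
  by (rule AE_completion) (rule AE_lborel_singleton)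

text \<open>The decomposition is arbitrary, as the one behind \<open>Fourier_p\<close> is picked by
  choice. In particular different decompositions of \<open>f\<close> give the same transform
  a.e.\<close>

lemma FourierHK_AE_eq_decomposition:
  assumes cont: "continuous_on UNIV f"
    and int: "\<And>s. s \<noteq> 0 \<Longrightarrow> (\<lambda>x. fker s x * f x) integrable_on UNIV"
    and dec: "\<forall>x. f x = f1 x + f2 x" and f1: "Lp 1 f1" and f2: "Lp 2 f2"
  shows "AE s in lebesgue. FourierHK f s = Fourier1 f1 s + Fourier2 f2 s"
proof -
  have "AE s in lebesgue. Fourier2 f2 s = FourierHK f s - Fourier1 f1 s"
  proof (rule Fourier2_AE_eq[OF f2], use AE_lebesgue_nonzero in eventually_elim)
    fix s :: real assume "s \<noteq> 0"
    have "trunc n f2 = (\<lambda>x. trunc n f x - trunc n f1 x)" for n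
      using dec by (auto simp: trunc_def)
    then have "Fourier1 (trunc n f2) s = Fourier1 (trunc n f) s - Fourier1 (trunc n f1) s" for n
      by (simp only: Fourier1_diff[OF Lp_1_trunc_of_continuous[OF cont] Lp_1_trunc[OF f1]])
    then show "(\<lambda>n. Fourier1 (trunc n f2) s) \<longlonglongrightarrow> FourierHK f s - Fourier1 f1 s"
      by (simp only: tendsto_diff Fourier1_trunc_tendsto_FourierHK[OF cont int[OF \<open>s \<noteq> 0\<close>]]
            Fourier1_trunc_tendsto_Fourier1[OF f1])
  qed
  then show ?thesis by eventually_elim simp
qed

lemma FourierHK_AE_eq_Fourier_p:
  assumes p: "1 \<le> p" "p \<le> 2" and f: "Lp p f" and cont: "continuous_on UNIV f"
    and int: "\<And>s. s \<noteq> 0 \<Longrightarrow> (\<lambda>x. fker s x * f x) integrable_on UNIV"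
  shows "AE s in lebesgue. FourierHK f s = Fourier_p p f s"
proof -
  consider "p = 1" | "p = 2" | "p \<noteq> 1" "p \<noteq> 2" by blast
  then show ?thesis
  proof cases
    case 1
    then show ?thesis using f by (simp add: Fourier_p_def Fourier1_eq_FourierHK)
  next
    case 2
    \<comment> \<open>The case p = 2 is the decomposition 0 + f.\<close>
    have "Fourier1 (\<lambda>_. 0) s = 0" for s by (simp add: Fourier1_def)
    moreover have "AE s in lebesgue. FourierHK f s = Fourier1 (\<lambda>_. 0) s + Fourier2 f s"
      using f 2 by (intro FourierHK_AE_eq_decomposition[OF cont int]) (auto simp: Lp_1_iff_integrable)
    ultimately show ?thesis using 2 by (simp add: Fourier_p_def)
  next
    case 3
    let ?P = "\<lambda>g. \<exists>f1 f2. (\<forall>x. f x = f1 x + f2 x) \<and> Lp 1 f1 \<and> Lp p f1 \<and> Lp 2 f2 \<and> Lp p f2 \<and>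
              g = (\<lambda>s. Fourier1 f1 s + Fourier2 f2 s)"
    obtain h1 h2 where "\<forall>x. f x = h1 x + h2 x" "Lp 1 h1" "Lp p h1" "Lp 2 h2" "Lp p h2"
      using Lp_split[OF f p] by blast
    then have "?P (\<lambda>s. Fourier1 h1 s + Fourier2 h2 s)" by blast
    \<comment> \<open>The splitting by size only shows that the choice is not vacuous; the
      decomposition extracted from it may be a different one.\<close>
    then have "?P (SOME g. ?P g)" by (rule someI[where P = ?P])
    moreover have "Fourier_p p f = (SOME g. ?P g)"
      using 3 by (simp add: Fourier_p_def)
    ultimately have "?P (Fourier_p p f)" by (simp only:)
    then obtain f1 f2 where dec: "\<forall>x. f x = f1 x + f2 x" "Lp 1 f1" "Lp 2 f2"
      and Fp: "Fourier_p p f = (\<lambda>s. Fourier1 f1 s + Fourier2 f2 s)" by blast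
    show ?thesis
      unfolding Fp by (rule FourierHK_AE_eq_decomposition[OF cont int dec])
  qed
qed

text \<open>\<open>Fourier1 \<psi>\<close> is continuous and bounded by a multiple of the L^1 norm
  of \<psi>; the decay at infinity comes from the factor 1/s.\<close>

lemma C_infty_punct_of_Fourier1:
  assumes \<psi>: "Lp 1 \<psi>" and F: "\<And>s. s \<noteq> 0 \<Longrightarrow> F s = - (\<i> / of_real s) * Fourier1 \<psi> s"
  shows "C_infty_punct F"
proof -
  let ?C = "1 / sqrt (2 * pi) * (\<integral>x. norm (\<psi> x) \<partial>lebesgue)"
  have bound: "norm (F s) \<le> ?C * inverse (norm s)" if "s \<noteq> 0" for s
  proof -
    have "norm (Fourier1 \<psi> s) \<le> ?C"
      unfolding Fourier1_def norm_mult norm_of_real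
      using \<psi> by (intro mult_mono norm_Fourier_integral_le) (auto simp: Lp_1_iff_integrable)
    then have "norm (Fourier1 \<psi> s) * inverse \<bar>s\<bar> \<le> ?C * inverse \<bar>s\<bar>"
      by (intro mult_right_mono) auto
    then show ?thesis using that by (simp add: F norm_mult norm_divide field_simps)
  qed
  have lim: "(F \<longlongrightarrow> 0) at_infinity"
  proof (rule Lim_null_comparison)
    have "eventually (\<lambda>s::real. s \<noteq> 0) at_infinity"
      unfolding eventually_at_infinity by (intro exI[of _ 1]) auto
    then show "eventually (\<lambda>s. norm (F s) \<le> ?C * inverse (norm s)) at_infinity"
      by eventually_elim (rule bound)
    have "((\<lambda>s::real. inverse (norm s)) \<longlongrightarrow> 0) at_infinity"
      by (rule tendsto_inverse_0_at_top) (rule filterlim_norm_at_top)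
    then show "((\<lambda>s::real. ?C * inverse (norm s)) \<longlongrightarrow> 0) at_infinity"
      by (rule tendsto_mult_right_zero)
  qed
  have "continuous_on (- {0}) (\<lambda>s. - (\<i> / of_real s) * Fourier1 \<psi> s)"
    using continuous_on_subset[OF continuous_on_Fourier1[OF \<psi>]]
    by (intro continuous_intros) auto
  then have "continuous_on (- {0}) F"
    using F by (subst continuous_on_cong[OF refl]) auto
  then show ?thesis
    unfolding C_infty_punct_def
    using lim at_top_le_at_infinity at_bot_le_at_infinity by (auto intro: tendsto_mono)
qed

text \<open>\<open>integral\<close> is 0 for functions without an integral, so integrability off 0
  is claimed first; it makes the values of \<open>FourierHK\<close> meaningful.\<close>

theorem mainTheorem2:
  fixes p :: real and \<phi> :: "real \<Rightarrow> real"
  assumes "1 \<le> p" and "p \<le> 2"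
    and "Lp p (\<lambda>x. complex_of_real (\<phi> x))"
    and "BV0 \<phi>" and "AC_loc \<phi>"
  shows "(\<forall>s. s \<noteq> 0 \<longrightarrow>
           (\<lambda>x. exp (- (\<i> * complex_of_real (s * x))) * complex_of_real (\<phi> x)) integrable_on UNIV)
    \<and> C_infty_punct (FourierHK (\<lambda>x. complex_of_real (\<phi> x)))
    \<and> (AE s in lebesgue. FourierHK (\<lambda>x. complex_of_real (\<phi> x)) s
                         = Fourier_p p (\<lambda>x. complex_of_real (\<phi> x)) s)
    \<and> Lp 1 (\<lambda>x. complex_of_real (deriv \<phi> x))
    \<and> (\<forall>s. s \<noteq> 0 \<longrightarrow> FourierHK (\<lambda>x. complex_of_real (\<phi> x)) s
           = - (\<i> / complex_of_real s) * Fourier1 (\<lambda>x. complex_of_real (deriv \<phi> x)) s)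
    \<and> (\<forall>s. s \<noteq> 0 \<longrightarrow> norm (FourierHK (\<lambda>x. complex_of_real (\<phi> x)) s)
           \<le> 1 / sqrt (2 * pi) * (1 / \<bar>s\<bar>) * (\<integral>x. \<bar>deriv \<phi> x\<bar> \<partial>lebesgue))"
proof -
  let ?\<phi> = "\<lambda>x. complex_of_real (\<phi> x)"
  let ?\<psi> = "\<lambda>x. complex_of_real (deriv \<phi> x)"
  have bv: "bounded_variation \<phi>" and top: "(\<phi> \<longlongrightarrow> 0) at_top" and bot: "(\<phi> \<longlongrightarrow> 0) at_bot"
    using \<open>BV0 \<phi>\<close> by (auto simp: BV0_def)
  have cont: "continuous_on UNIV \<phi>" by (rule AC_loc_imp_continuous_on[OF \<open>AC_loc \<phi>\<close>])
  obtain g where g: "integrable lborel g" "g \<in> borel_measurable borel"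
    and g\<phi>: "\<And>a b. a \<le> b \<Longrightarrow> (g has_integral \<phi> b - \<phi> a) {a..b}"
    and g': "AE x in lebesgue. (\<phi> has_real_derivative g x) (at x)"
    using AC_BV_integrable_derivative[OF \<open>AC_loc \<phi>\<close> bv] by metis
  have eq: "AE x in lebesgue. g x = deriv \<phi> x"
    using g' by eventually_elim (simp add: DERIV_imp_deriv)
  have gleb: "integrable lebesgue g"
    using g by (subst integrable_completion) auto
  \<comment> \<open>Where \<phi> is not differentiable, \<open>deriv \<phi>\<close> is an arbitrary
    value. These points form a null set, and completeness of \<open>lebesgue\<close> transfers
    measurability from \<open>g\<close>.\<close>
  have derivm: "deriv \<phi> \<in> borel_measurable lebesgue"
    by (rule borel_measurable_AE[OF borel_measurable_integrable[OF gleb] eq])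
  have deriv_int: "integrable lebesgue (deriv \<phi>)"
    using integrable_cong_AE[OF borel_measurable_integrable[OF gleb] derivm eq] gleb by simp
  then have \<psi>: "Lp 1 ?\<psi>"
    unfolding Lp_1_iff_integrable by (rule integrable_of_real)
  have g_\<psi>: "(\<integral>x. fker s x * of_real (g x) \<partial>lborel) = (\<integral>x. fker s x * ?\<psi> x \<partial>lebesgue)" for s
  proof -
    have "(\<integral>x. fker s x * of_real (g x) \<partial>lborel) = (\<integral>x. fker s x * complex_of_real (g x) \<partial>lebesgue)"
      using g(2) by (intro integral_completion[symmetric]) simp
    also have "\<dots> = (\<integral>x. fker s x * ?\<psi> x \<partial>lebesgue)"
    proof (rule integral_cong_AE)
      show "(\<lambda>x. fker s x * complex_of_real (g x)) \<in> borel_measurable lebesgue"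
        using gleb by (intro borel_measurable_integrable integrable_fker_mult integrable_of_real borel_measurable_fker_lebesgue)
      show "(\<lambda>x. fker s x * ?\<psi> x) \<in> borel_measurable lebesgue"
        by (rule borel_measurable_integrable[OF integrable_fker_Lp_1[OF \<psi>]])
    qed (use eq in auto)
    finally show ?thesis .
  qed
  have HK: "((\<lambda>x. fker s x * ?\<phi> x) has_integral - (\<i> / of_real s) * (\<integral>x. fker s x * ?\<psi> x \<partial>lebesgue)) UNIV"
    if "s \<noteq> 0" for s
    using has_integral_fker_UNIV[OF g(1) g\<phi> cont top bot that] by (simp only: g_\<psi>)
  then have int: "(\<lambda>x. fker s x * ?\<phi> x) integrable_on UNIV" if "s \<noteq> 0" for s
    using that by blast
  have iii: "FourierHK ?\<phi> s = - (\<i> / complex_of_real s) * Fourier1 ?\<psi> s" if "s \<noteq> 0" for s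
    unfolding FourierHK_def integral_unique[OF HK[OF that]] Fourier1_def by (simp only: mult.left_commute)
  have iv: "norm (FourierHK ?\<phi> s) \<le> 1 / sqrt (2 * pi) * (1 / \<bar>s\<bar>) * (\<integral>x. \<bar>deriv \<phi> x\<bar> \<partial>lebesgue)"
    if "s \<noteq> 0" for s
  proof -
    have "norm (\<integral>x. fker s x * ?\<psi> x \<partial>lebesgue) \<le> (\<integral>x. \<bar>deriv \<phi> x\<bar> \<partial>lebesgue)"
      using norm_Fourier_integral_le[of ?\<psi> s] \<psi> by (simp add: Lp_1_iff_integrable)
    then have "1 / sqrt (2 * pi) * (1 / \<bar>s\<bar>) * norm (\<integral>x. fker s x * ?\<psi> x \<partial>lebesgue)
      \<le> 1 / sqrt (2 * pi) * (1 / \<bar>s\<bar>) * (\<integral>x. \<bar>deriv \<phi> x\<bar> \<partial>lebesgue)"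
      by (intro mult_left_mono) auto
    moreover have "norm (FourierHK ?\<phi> s) = 1 / sqrt (2 * pi) * (1 / \<bar>s\<bar>) * norm (\<integral>x. fker s x * ?\<psi> x \<partial>lebesgue)"
      unfolding iii[OF that] Fourier1_def norm_mult norm_minus_cancel norm_divide norm_of_real norm_ii by simp
    ultimately show ?thesis by (simp only:)
  qed
  have cont\<phi>: "continuous_on UNIV ?\<phi>" by (intro continuous_intros cont)
  have "AE s in lebesgue. FourierHK ?\<phi> s = Fourier_p p ?\<phi> s"
    by (rule FourierHK_AE_eq_Fourier_p[OF assms(1-3) cont\<phi> int])
  moreover have "C_infty_punct (FourierHK ?\<phi>)"
    by (rule C_infty_punct_of_Fourier1[OF \<psi> iii])
  ultimately show ?thesis
    using int iii iv \<psi> by blast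
qed

end
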